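(* For every $N\ge 1$ and all processes $P_1,\ldots,P_N$, the algorithm SpOptN (described in the context) terminates on input $P_1,\ldots,P_N$ and returns $\mathrm{spmin}(P_1,\ldots,P_N)$.
   Context: **Processes and space.** A process is a nonempty finite list of non-negative integers. Let $P_i=[p_{i,1},\ldots,p_{i,m_i}]$, $i=1,\ldots,N$, be processes. An interleaving of $P_1,\ldots,P_N$ is a list $[q_1,\ldots,q_h]$ of $N$-tuples for which there are index tuples $s_1,\ldots,s_h$ with $s_1=(1,\ldots,1)$, $s_h=(m_1,\ldots,m_N)$, for each $t<h$: $s_{t+1}\neq s_t$ and $s_{t+1,i}\in\{s_{t,i},s_{t,i}+1\}$ for all $i$, and $q_t=(p_{1,s_{t,1}},\ldots,p_{N,s_{t,N}})$. (Each process proceeds by at most one step at a time, at least one process proceeds, and a finished process stays at its last element.) The space usage $\mathrm{sps}(S)$ of an interleaving $S$ is the maximum over the tuples in $S$ of the sum of the entries of the tuple. $\mathrm{spmin}(P_1,\ldots,P_N)$ is the minimum of $\mathrm{sps}(S)$ over all interleavings $S$. A start-peak (end-peak) of a process of length at least 2 is its first (last) element if it is not smaller than its neighbour. A global valley of a process is an occurrence of its minimum value. **Patterns.** For a process $[a_1,\ldots,a_k]$ and an index $i$: - $M_0$ matches at $i$ if $a_i=a_{i+1}$; $M_1$ if $a_i\le a_{i+1}\le a_{i+2}$; $M_2$ if $a_i\ge a_{i+1}\ge a_{i+2}$. Reduction for $M_0,M_1,M_2$: remove $a_{i+1}$. - $M_3$ matches at $i$ if $a_i>a_{i+1}$, $a_{i+1}<a_{i+2}$,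 $a_{i+2}>a_{i+3}$, $a_i\ge a_{i+2}$, $a_{i+1}\ge a_{i+3}$; $M_4$ matches at $i$ if $a_i<a_{i+1}$, $a_{i+1}>a_{i+2}$, $a_{i+2}<a_{i+3}$, $a_i\le a_{i+2}$, $a_{i+1}\le a_{i+3}$. Reduction for $M_3,M_4$: remove $a_{i+1},a_{i+2}$. **Standardization.** (1) Reduce every process with $M_0,\ldots,M_4$ until no pattern matches (scan from left to right; after a reduction at index $j$ restart the scan at index $j-3$, or at the beginning if $j-3$ is before the beginning; otherwise go on with $j+1$). (2) Remove the start-peak of each process that has one and has length at least 2. (3) Then remove the end-peak of each process that has one and has length at least 2. (4) Remove all one-element processes. **Left scan** of standardized processes $P_i=[p_{i,1},\ldots,p_{i,n_i}]$. Let $I_{i,\mathrm{ends}}$ be the index in $P_i$ of its rightmost global valley. 1. Build a search tree $T$ containing the pair $(p_{i,2}-p_{i,1},\,i)$ for each $P_i$, with the first component as search key. 2. Set $S=M=\sum_i p_{i,1}$ and $I_i=1$ for each $i$. 3. If $T$ is empty, return $M$. 4. Remove a minimal element $(d,i)$ from $T$. If $I_i+2\le I_{i,\mathrm{ends}}$, then set $M=\max(M,S+d)$, $S=S+(p_{i,3}-p_{i,1})$, insert $(p_{i,4}-p_{i,3},i)$ into $T$ (only if $P_i$ currently contains at least 4 elements), set $I_i=I_i+2$, and remove the first two elements from $P_i$ (elements of $P_i$ are then re-indexed from 1). Go to 3. The right scan is the symmetric (right-to-left) version, scanning each process from its right end, going only as far as the rightmost global valley. **SpOptN** on input $P_1,\ldots,P_N$: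 1. Let $M_{\mathrm{start}}$ be the sum of all first elements and $M_{\mathrm{end}}$ the sum of all last elements of $P_1,\ldots,P_N$. 2. Transform the processes into standard form by standardization; let $M_{\mathrm{one}}$ be the sum of the elements of all one-element processes removed in step (4) of standardization. 3. Compute $M_{\mathrm{left}}$ by the left scan and $M_{\mathrm{right}}$ by the right scan of the resulting standardized processes (both are $0$ if no process is left). 4. Return the maximum of $M_{\mathrm{left}}+M_{\mathrm{one}}$, $M_{\mathrm{right}}+M_{\mathrm{one}}$, $M_{\mathrm{start}}$, $M_{\mathrm{end}}$. *)

theory Defs
  imports "HOL-Library.While_Combinator"
begin

text \<open>
  All list indices below start at 0, so an index \<open>j\<close> of the informal description
  is the index \<open>j - 1\<close> here. A process is a nonempty \<open>nat list\<close>.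
\<close>

section \<open>Interleavings and space usage\<close>

definition interleaving :: "nat list list \<Rightarrow> nat list list \<Rightarrow> bool" where
  "interleaving Ps qs \<longleftrightarrow>
     (\<exists>ss. ss \<noteq> [] \<and> (\<forall>s\<in>set ss. length s = length Ps) \<and>
           hd ss = map (\<lambda>P. 0) Ps \<and>
           last ss = map (\<lambda>P. length P - 1) Ps \<and>
           (\<forall>t. Suc t < length ss \<longrightarrow>
              ss ! Suc t \<noteq> ss ! t \<and>
              (\<forall>i<length Ps. ss ! Suc t ! i = ss ! t ! i \<or> ss ! Suc t ! i = ss ! t ! i + 1)) \<and>
           qs = map (\<lambda>s. map2 (!) Ps s) ss)"

definition sps :: "nat list list \<Rightarrow> nat" where
  "sps qs = Max (sum_list ` set qs)"

definition spmin :: "nat list list \<Rightarrow> nat" where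
  "spmin Ps = (LEAST m. \<exists>qs. interleaving Ps qs \<and> sps qs = m)"

section \<open>Standardization\<close>

definition M0 :: "nat list \<Rightarrow> nat \<Rightarrow> bool" where
  "M0 a i \<longleftrightarrow> i + 1 < length a \<and> a ! i = a ! (i+1)"

definition M1 :: "nat list \<Rightarrow> nat \<Rightarrow> bool" where
  "M1 a i \<longleftrightarrow> i + 2 < length a \<and> a ! i \<le> a ! (i+1) \<and> a ! (i+1) \<le> a ! (i+2)"

definition M2 :: "nat list \<Rightarrow> nat \<Rightarrow> bool" where
  "M2 a i \<longleftrightarrow> i + 2 < length a \<and> a ! i \<ge> a ! (i+1) \<and> a ! (i+1) \<ge> a ! (i+2)"

definition M3 :: "nat list \<Rightarrow> nat \<Rightarrow> bool" where
  "M3 a i \<longleftrightarrow> i + 3 < length a \<and>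
     a ! i > a ! (i+1) \<and> a ! (i+1) < a ! (i+2) \<and> a ! (i+2) > a ! (i+3) \<and>
     a ! i \<ge> a ! (i+2) \<and> a ! (i+1) \<ge> a ! (i+3)"

definition M4 :: "nat list \<Rightarrow> nat \<Rightarrow> bool" where
  "M4 a i \<longleftrightarrow> i + 3 < length a \<and>
     a ! i < a ! (i+1) \<and> a ! (i+1) > a ! (i+2) \<and> a ! (i+2) < a ! (i+3) \<and>
     a ! i \<le> a ! (i+2) \<and> a ! (i+1) \<le> a ! (i+3)"

text \<open>
  At a given index, \<open>M3\<close> and \<open>M4\<close> exclude each other and the other patterns, and
  \<open>M0\<close>, \<open>M1\<close>, \<open>M2\<close> have the same reduction, so the order of the tests is immaterial.
  Truncated subtraction in \<open>i - 3\<close> yields the restart at the beginning when needed.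
\<close>

definition reduce_step :: "nat list \<times> nat \<Rightarrow> nat list \<times> nat" where
  "reduce_step = (\<lambda>(a, i).
     if M0 a i \<or> M1 a i \<or> M2 a i then (take (i+1) a @ drop (i+2) a, i - 3)
     else if M3 a i \<or> M4 a i then (take (i+1) a @ drop (i+3) a, i - 3)
     else (a, i + 1))"

text \<open>The value is \<open>None\<close> iff the scan does not terminate.\<close>

definition reduce :: "nat list \<Rightarrow> nat list option" where
  "reduce P = map_option fst (while_option (\<lambda>(a, i). i < length a) reduce_step (P, 0))"

definition remove_start_peak :: "nat list \<Rightarrow> nat list" where
  "remove_start_peak a = (if length a \<ge> 2 \<and> a ! 0 \<ge> a ! 1 then tl a else a)"

definition remove_end_peak :: "nat list \<Rightarrow> nat list" where
  "remove_end_peak a =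
     (if length a \<ge> 2 \<and> a ! (length a - 1) \<ge> a ! (length a - 2) then butlast a else a)"

text \<open>
  The standardized processes together with the sum of the elements of the removed
  one-element processes; \<open>None\<close> iff the reduction of some process does not terminate.
\<close>

definition standardize :: "nat list list \<Rightarrow> (nat list list \<times> nat) option" where
  "standardize Ps =
     map_option
       (\<lambda>Rs. let Qs = map (\<lambda>R. remove_end_peak (remove_start_peak R)) Rs
             in (filter (\<lambda>Q. length Q \<noteq> 1) Qs,
                 (\<Sum>Q\<leftarrow>filter (\<lambda>Q. length Q = 1) Qs. Q ! 0)))
       (those (map reduce Ps))"

section \<open>Left and right scan\<close>

definition rightmost_valley :: "nat list \<Rightarrow> nat" where
  "rightmost_valley P = Max {i. i < length P \<and> P ! i = Min (set P)}"

text \<open>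
  A state \<open>(T, S, M, I, Ps)\<close> holds the search tree (as the set of its elements), the two
  sums, the positions and the current processes. The scan is a relation because several
  elements of \<open>T\<close> may have the same minimal key, and any of them may be removed.
  A step is possible whenever the (finite) tree is nonempty, so a run can only end by
  returning.
\<close>

type_synonym scan_state = "(int \<times> nat) set \<times> int \<times> int \<times> nat list \<times> nat list list"

definition scan_init :: "nat list list \<Rightarrow> scan_state" where
  "scan_init Ps =
     (let s = (\<Sum>P\<leftarrow>Ps. int (P ! 0))
      in ((\<lambda>i. (int (Ps ! i ! 1) - int (Ps ! i ! 0), i)) ` {..<length Ps},
          s, s, replicate (length Ps) 0, Ps))"

definition minimal_in :: "int \<times> nat \<Rightarrow> (int \<times> nat) set \<Rightarrow> bool" where
  "minimal_in x T \<longleftrightarrow> x \<in> T \<and> (\<forall>y\<in>T. fst x \<le> fst y)"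

inductive scan_step :: "nat list \<Rightarrow> scan_state \<Rightarrow> scan_state \<Rightarrow> bool"
  for ends :: "nat list" where
  advance:
    "\<lbrakk>minimal_in (d, i) T; I ! i + 2 \<le> ends ! i; P = Ps ! i;
      T' = T - {(d, i)} \<union> (if length P \<ge> 4 then {(int (P ! 3) - int (P ! 2), i)} else {})\<rbrakk>
     \<Longrightarrow> scan_step ends (T, S, M, I, Ps)
           (T', S + (int (P ! 2) - int (P ! 0)), max M (S + d),
            I[i := I ! i + 2], Ps[i := drop 2 P])"
| stop:
    "\<lbrakk>minimal_in (d, i) T; \<not> I ! i + 2 \<le> ends ! i\<rbrakk>
     \<Longrightarrow> scan_step ends (T, S, M, I, Ps) (T - {(d, i)}, S, M, I, Ps)"

definition scan_terminates :: "nat list \<Rightarrow> nat list list \<Rightarrow> bool" where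
  "scan_terminates ends Ps \<longleftrightarrow>
     (\<nexists>f. f 0 = scan_init Ps \<and> (\<forall>n. scan_step ends (f n) (f (Suc n))))"

definition scan_returns :: "nat list \<Rightarrow> nat list list \<Rightarrow> int \<Rightarrow> bool" where
  "scan_returns ends Ps m \<longleftrightarrow>
     (\<exists>S I Ps'. (scan_step ends)\<^sup>*\<^sup>* (scan_init Ps) ({}, S, m, I, Ps'))"

definition left_ends :: "nat list list \<Rightarrow> nat list" where
  "left_ends Ps = map rightmost_valley Ps"

text \<open>
  The right scan is the scan of the reversed processes; it goes as far as the position
  which the rightmost global valley of the original process takes after the reversal.
\<close>

definition right_ends :: "nat list list \<Rightarrow> nat list" where
  "right_ends Ps = map (\<lambda>P. length P - 1 - rightmost_valley P) Ps"

definition left_scan_terminates :: "nat list list \<Rightarrow> bool" where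
  "left_scan_terminates Ps \<longleftrightarrow> scan_terminates (left_ends Ps) Ps"

definition left_scan_returns :: "nat list list \<Rightarrow> int \<Rightarrow> bool" where
  "left_scan_returns Ps m \<longleftrightarrow> scan_returns (left_ends Ps) Ps m"

definition right_scan_terminates :: "nat list list \<Rightarrow> bool" where
  "right_scan_terminates Ps \<longleftrightarrow> scan_terminates (right_ends Ps) (map rev Ps)"

definition right_scan_returns :: "nat list list \<Rightarrow> int \<Rightarrow> bool" where
  "right_scan_returns Ps m \<longleftrightarrow> scan_returns (right_ends Ps) (map rev Ps) m"

section \<open>The algorithm\<close>

text \<open>
  \<open>SpOptN_terminates\<close> says that every run is finite, and \<open>SpOptN_returns Ps r\<close> that
  some run returns \<open>r\<close>. If no process is left after standardization, the initial state
  of both scans has an empty tree and sum 0, so both scans return 0.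
\<close>

definition SpOptN_terminates :: "nat list list \<Rightarrow> bool" where
  "SpOptN_terminates Ps \<longleftrightarrow>
     (\<exists>Qs m_one. standardize Ps = Some (Qs, m_one) \<and>
        left_scan_terminates Qs \<and> right_scan_terminates Qs)"

definition SpOptN_returns :: "nat list list \<Rightarrow> int \<Rightarrow> bool" where
  "SpOptN_returns Ps r \<longleftrightarrow>
     (\<exists>Qs m_one m_left m_right.
        standardize Ps = Some (Qs, m_one) \<and>
        left_scan_returns Qs m_left \<and> right_scan_returns Qs m_right \<and>
        r = Max {m_left + int m_one, m_right + int m_one,
                 (\<Sum>P\<leftarrow>Ps. int (hd P)), (\<Sum>P\<leftarrow>Ps. int (last P))})"

end

theory Submission
  imports Defs
begin

text \<open>
  A bound \<open>m\<close> on the space usage is achievable iff there is a monotone lattice path of cost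
  at most \<open>m\<close> from the first to the last positions; two natural numbers are equal if they
  have the same upper bounds. Each reduction lets one imitate a path before the reduction by
  one after it, and conversely, at no extra cost. Because of the absence of patterns, the
  valleys of a standardized process descend from both ends towards a global valley, so the
  instance splits at the global valleys into two scans. There the current position of each
  process is its lowest one so far, hence some process has to pay for its next peak
  while the others pay at least for their current valleys; the cheapest increase to a next peak
  is therefore a lower bound, and the greedy scan attains it.
\<close>

section \<open>Lattice paths of bounded cost\<close>

text \<open>Upper bounds compose better than minima: removing peaks, removing constant processes and
  splitting at the valleys all become conjunctions of bounds. The obstacle in the reductions is an
  asymmetry. Deleting elements is imitated position by position, for each process by itself
  (\<open>dominates\<close>). Restoring them is not: the process has to run through the restored
  elements while all others stand still, so one move is answered by many. A reduction is therefore
  justified for one process among arbitrary others (\<open>interchangeable\<close>), and the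
  processes are replaced one at a time. Moves that change nothing are allowed because imitation may
  collapse moves; they are discarded only when a path is turned into an interleaving. Time reversal
  halves the work: ascending patterns, end-peaks and the right scan are mirror images.\<close>

definition cost :: "nat set \<Rightarrow> (nat \<Rightarrow> nat list) \<Rightarrow> (nat \<Rightarrow> nat) \<Rightarrow> nat" where
  "cost A p s = (\<Sum>i\<in>A. p i ! s i)"

definition admissible :: "nat set \<Rightarrow> (nat \<Rightarrow> nat list) \<Rightarrow> nat \<Rightarrow> (nat \<Rightarrow> nat) \<Rightarrow> bool" where
  "admissible A p m s \<longleftrightarrow> (\<forall>i\<in>A. s i < length (p i)) \<and> cost A p s \<le> m"

text \<open>
  Unlike in an interleaving, a move may leave all positions unchanged. Positions outside
  the index set \<open>A\<close> are irrelevant and may change arbitrarily.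
\<close>

definition move ::
  "nat set \<Rightarrow> (nat \<Rightarrow> nat list) \<Rightarrow> nat \<Rightarrow> (nat \<Rightarrow> nat) \<Rightarrow> (nat \<Rightarrow> nat) \<Rightarrow> bool" where
  "move A p m s t \<longleftrightarrow> admissible A p m s \<and> admissible A p m t \<and>
     (\<forall>i\<in>A. t i = s i \<or> t i = Suc (s i))"

text \<open>\<open>move\<close> relates every admissible position to itself, so the strict closure
  loses no path, yet it certifies that both ends are admissible; the reflexive closure would
  not.\<close>

abbreviation reach ::
  "nat set \<Rightarrow> (nat \<Rightarrow> nat list) \<Rightarrow> nat \<Rightarrow> (nat \<Rightarrow> nat) \<Rightarrow> (nat \<Rightarrow> nat) \<Rightarrow> bool" where
  "reach A p m \<equiv> (move A p m)\<^sup>+\<^sup>+"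

definition feasible :: "nat set \<Rightarrow> (nat \<Rightarrow> nat list) \<Rightarrow> nat \<Rightarrow> bool" where
  "feasible A p m \<longleftrightarrow> reach A p m (\<lambda>_. 0) (\<lambda>i. length (p i) - 1)"

lemma admissible_mono:
  assumes "admissible A p m s"
    and "\<And>i. i \<in> A \<Longrightarrow> s i < length (p i) \<Longrightarrow> t i < length (q i) \<and> q i ! t i \<le> p i ! s i"
  shows "admissible A q m t"
proof -
  have "cost A q t \<le> cost A p s"
    unfolding cost_def using assms by (intro sum_mono) (auto simp: admissible_def)
  with assms show ?thesis
    by (auto simp: admissible_def)
qed

lemma admissible_cong:
  assumes "\<And>i. i \<in> A \<Longrightarrow> p i = q i" "\<And>i. i \<in> A \<Longrightarrow> s i = t i"
  shows "admissible A p m s \<longleftrightarrow> admissible A q m t"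
proof -
  have "cost A p s = cost A q t"
    unfolding cost_def using assms by (intro sum.cong) auto
  with assms show ?thesis
    by (auto simp: admissible_def)
qed

lemma reach_admissible:
  assumes "reach A p m s t"
  shows "admissible A p m s" "admissible A p m t"
  using assms by (induction) (auto simp: move_def)

text \<open>The new endpoints agree with the old ones on \<open>A\<close>, where a move may leave
  everything unchanged, so one additional move at each end suffices.\<close>

lemma reach_cong:
  assumes "reach A p m s t" "\<And>i. i \<in> A \<Longrightarrow> p i = q i"
    and "\<And>i. i \<in> A \<Longrightarrow> s i = s' i" "\<And>i. i \<in> A \<Longrightarrow> t i = t' i"
  shows "reach A q m s' t'"
proof -
  have adm: "admissible A p m u \<longleftrightarrow> admissible A q m u" for u
    by (rule admissible_cong) (use assms(2) in auto)
  have "move A p m = move A q m"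
    by (auto simp: move_def adm fun_eq_iff)
  then have r: "reach A q m s t"
    using assms(1) by simp
  have "admissible A q m s'" "admissible A q m t'"
    using reach_admissible[OF r] assms(3,4) admissible_cong[of A q q] by metis+
  with reach_admissible[OF r] assms(3,4) have "move A q m s' s" "move A q m t t'"
    by (auto simp: move_def)
  with r show ?thesis
    by (meson tranclp.trancl_into_trancl tranclp_into_tranclp2)
qed

lemma feasible_cong:
  assumes "\<And>i. i \<in> A \<Longrightarrow> p i = q i"
  shows "feasible A p m \<longleftrightarrow> feasible A q m"
proof -
  have "feasible A q m" if "feasible A p m" "\<And>i. i \<in> A \<Longrightarrow> p i = q i" for p q
    using that(1) unfolding feasible_def by (rule reach_cong) (simp_all add: that(2))
  from this[of p q] this[of q p] assms show ?thesis
    by auto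
qed

lemma feasible_iff_reach:
  assumes "\<And>i. i \<in> A \<Longrightarrow> s i = 0" "\<And>i. i \<in> A \<Longrightarrow> t i = length (p i) - 1"
  shows "feasible A p m \<longleftrightarrow> reach A p m s t"
  unfolding feasible_def using assms
    reach_cong[of A p m s t p "\<lambda>_. 0" "\<lambda>i. length (p i) - 1"]
    reach_cong[of A p m "\<lambda>_. 0" "\<lambda>i. length (p i) - 1" p s t]
  by auto

text \<open>One move may be answered by a whole path; the insertion of elements relies on
  this.\<close>

lemma reach_map:
  assumes "reach A p m s t"
    and "\<And>u v. move A p m u v \<Longrightarrow> reach B q k (h u) (h v)"
  shows "reach B q k (h s) (h t)"
  using assms(1)
proof induction
  case (step u v)
  then show ?case
    using assms(2)[of u v] by (meson tranclp_trans)
qed (rule assms(2))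

text \<open>Reflecting positions turns a step forward into a step backward. Admissible positions are
  in range, so the truncated subtraction is a true reflection.\<close>

lemma reach_rev:
  assumes "reach A p m s t"
  shows "reach A (\<lambda>i. rev (p i)) m (\<lambda>i. length (p i) - 1 - t i) (\<lambda>i. length (p i) - 1 - s i)"
proof -
  let ?h = "\<lambda>s i. length (p i) - 1 - s i"
  have adm: "admissible A (\<lambda>i. rev (p i)) m (?h u)" if "admissible A p m u" for u
    by (rule admissible_mono[OF that]) (auto simp: rev_nth Suc_diff_Suc)
  have mv: "move A (\<lambda>i. rev (p i)) m (?h v) (?h u)" if "move A p m u v" for u v
    using that adm[of u] adm[of v] by (fastforce simp: move_def admissible_def)
  show ?thesis
    using assms
  proof induction
    case (base u)
    then show ?case
      using mv[of s u] by blast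
  next
    case (step u v)
    then show ?case
      using mv[of u v] by (meson tranclp_into_tranclp2)
  qed
qed

lemma feasible_rev: "feasible A (\<lambda>i. rev (p i)) m \<longleftrightarrow> feasible A p m"
proof -
  have *: "feasible A (\<lambda>i. rev (p i)) m" if "feasible A p m" for p
    using reach_rev[OF that[unfolded feasible_def]]
    by (auto simp: feasible_iff_reach[of A "\<lambda>i. length (p i) - 1 - (length (p i) - 1)"])
  show ?thesis
    using *[of p] *[of "\<lambda>i. rev (p i)"] by auto
qed

text \<open>\<open>f j\<close> is the position held in \<open>Q\<close> while \<open>P\<close> is at
  \<open>j\<close>. It depends neither on the other processes nor on the past, so all processes can
  be translated at once and each move becomes one move.\<close>

definition dominates :: "nat list \<Rightarrow> nat list \<Rightarrow> bool" where
  "dominates P Q \<longleftrightarrow> (\<exists>f. f 0 = 0 \<and> f (length P - 1) = length Q - 1 \<and>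
     (\<forall>j. Suc j < length P \<longrightarrow> f (Suc j) = f j \<or> f (Suc j) = Suc (f j)) \<and>
     (\<forall>j<length P. f j < length Q \<and> Q ! f j \<le> P ! j))"

lemma dominates_refl: "dominates P P"
  unfolding dominates_def by (intro exI[of _ id]) auto

lemma feasible_dominates:
  assumes "feasible A p m" "\<And>i. i \<in> A \<Longrightarrow> dominates (p i) (q i)"
  shows "feasible A q m"
proof -
  obtain f where f: "\<And>i. i \<in> A \<Longrightarrow> f i 0 = 0 \<and> f i (length (p i) - 1) = length (q i) - 1 \<and>
     (\<forall>j. Suc j < length (p i) \<longrightarrow> f i (Suc j) = f i j \<or> f i (Suc j) = Suc (f i j)) \<and>
     (\<forall>j<length (p i). f i j < length (q i) \<and> q i ! f i j \<le> p i ! j)"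
    using assms(2) unfolding dominates_def by metis
  let ?h = "\<lambda>s i. f i (s i)"
  have adm: "admissible A q m (?h u)" if "admissible A p m u" for u
    by (rule admissible_mono[OF that]) (use f in blast)
  have mv: "move A q m (?h u) (?h v)" if uv: "move A p m u v" for u v
    unfolding move_def
  proof (intro conjI ballI)
    fix i assume "i \<in> A"
    with uv have "v i = u i \<or> v i = Suc (u i)" "v i < length (p i)"
      by (auto simp: move_def admissible_def)
    with f \<open>i \<in> A\<close> show "f i (v i) = f i (u i) \<or> f i (v i) = Suc (f i (u i))"
      by metis
  qed (use uv adm in \<open>auto simp: move_def\<close>)
  have "reach A q m (?h (\<lambda>_. 0)) (?h (\<lambda>i. length (p i) - 1))"
    by (rule reach_map[OF assms(1)[unfolded feasible_def]]) (use mv in blast)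
  then show ?thesis
    using f by (subst feasible_iff_reach) auto
qed

text \<open>
  The inserted values are visited while the other processes rest just after the process
  has arrived at \<open>x\<close>.
\<close>

lemma feasible_insert:
  assumes k: "k \<in> A" and pk: "p k = xs @ x # ys @ zs" and le: "\<forall>y\<in>set ys. y \<le> x"
    and feas: "feasible A (p(k := xs @ x # zs)) m"
  shows "feasible A p m"
proof -
  define n c q where "n = length xs" and "c = length ys" and "q = p(k := xs @ x # zs)"
  \<comment> \<open>From index \<open>n\<close> on, positions are shifted by \<open>c\<close>; in
    particular, arrival at \<open>x\<close> is translated to the end of the block
    \<open>x # ys\<close>.\<close>
  define h where "h = (\<lambda>s. s(k := if s k < n then s k else s k + c))"
  have nth_ys: "p k ! (n + d) \<le> x" if "d \<le> c" for d
    using that le by (cases d) (auto simp: pk n_def c_def nth_append)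
  have qk: "q k = xs @ x # zs" and qi: "\<And>i. i \<noteq> k \<Longrightarrow> q i = p i"
    by (auto simp: q_def)
  have qn: "q k ! n = x"
    by (simp add: qk n_def)
  have tail: "p k ! (j + c) = q k ! j" if j: "n < j" for j
  proof -
    obtain e where "j = Suc (n + e)"
      using less_imp_Suc_add[OF j] by auto
    then show ?thesis
      by (simp add: pk qk n_def c_def nth_append)
  qed
  have head: "p k ! j = q k ! j" if "j < n" for j
    using that by (simp add: pk qk n_def nth_append)
  have len: "length (p k) = length (q k) + c"
    by (simp add: pk qk c_def)
  have adm_h: "admissible A p m (h s)" if "admissible A q m s" for s
  proof (rule admissible_mono[OF that])
    fix i assume "i \<in> A" "s i < length (q i)"
    moreover have "p k ! (if s k < n then s k else s k + c) \<le> q k ! s k"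
      using head[of "s k"] tail[of "s k"] nth_ys[of c] qn
      by (cases "s k" n rule: linorder_cases) auto
    ultimately show "h s i < length (p i) \<and> p i ! h s i \<le> q i ! s i"
      using qi len by (cases "i = k") (auto simp: h_def)
  qed
  have adm_n: "admissible A p m (s(k := n + d))" if "admissible A q m s" "s k = n" "d \<le> c" for s d
  proof (rule admissible_mono[OF that(1)])
    fix i assume "i \<in> A" "s i < length (q i)"
    then show "(s(k := n + d)) i < length (p i) \<and> p i ! (s(k := n + d)) i \<le> q i ! s i"
      using qi len nth_ys[OF \<open>d \<le> c\<close>] qn that by (cases "i = k") auto
  qed
  have walk: "reach A p m s (s(k := n + d))" if "admissible A q m s" "s k = n" "d \<le> c" for s d
    using \<open>d \<le> c\<close>
  proof (induction d)
    case 0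
    have "s(k := n + 0) = s"
      using that by auto
    then show ?case
      using adm_n[OF that(1,2), of 0] by (auto simp: move_def)
  next
    case (Suc d)
    have "move A p m (s(k := n + d)) (s(k := n + Suc d))"
      using adm_n[OF that(1,2), of d] adm_n[OF that(1,2), of "Suc d"] Suc.prems
      by (auto simp: move_def)
    with Suc show ?case
      by (meson Suc_leD tranclp.trancl_into_trancl)
  qed
  have arrive: "h s = s(k := n + c)" if "s k = n" for s
    using that by (auto simp: h_def)
  have mv: "reach A p m (h u) (h v)" if uv: "move A q m u v" for u v
  \<comment> \<open>Only a move in which \<open>k\<close> arrives at \<open>x\<close> needs more
    than one move: all processes move as in \<open>v\<close>, with \<open>k\<close> at
    \<open>x\<close>, and then \<open>k\<close> alone walks through \<open>ys\<close>.\<close>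
  proof (cases "u k < n \<and> v k = n")
    case True
    have "h u = u"
      using True by (auto simp: h_def)
    moreover have "v(k := n) = v"
      using True by auto
    ultimately have "move A p m (h u) v"
      using uv adm_h[of u] adm_n[of v 0] True by (auto simp: move_def)
    moreover have "reach A p m v (h v)"
      using walk[of v c] arrive[of v] uv True by (simp add: move_def)
    ultimately show ?thesis
      by (meson tranclp_into_tranclp2)
  next
    case False
    have "h v i = h u i \<or> h v i = Suc (h u i)" if "i \<in> A" for i
    proof -
      have "v i = u i \<or> v i = Suc (u i)"
        using uv that by (auto simp: move_def)
      then show ?thesis
        using False by (auto simp: h_def)
    qed
    then have "move A p m (h u) (h v)"
      using uv adm_h by (auto simp: move_def)
    then show ?thesis
      by blast
  qed
  have r: "reach A q m (\<lambda>_. 0) (\<lambda>i. length (q i) - 1)"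
    using feas by (simp add: feasible_def q_def)
  have "reach A p m (\<lambda>_. 0) (h (\<lambda>_. 0))"
  \<comment> \<open>With \<open>xs\<close> empty the process starts at \<open>x\<close> and no move
    arrives there, so \<open>ys\<close> is walked through before anything else.\<close>
  proof (cases "n = 0")
    case True
    then show ?thesis
      using walk[OF reach_admissible(1)[OF r], of c] arrive[of "\<lambda>_. 0"] by simp
  next
    case False
    then have "h (\<lambda>_. 0) = (\<lambda>_. 0)"
      by (auto simp: h_def)
    then show ?thesis
      using adm_h[OF reach_admissible(1)[OF r]] by (auto simp: move_def)
  qed
  moreover have "reach A p m (h (\<lambda>_. 0)) (h (\<lambda>i. length (q i) - 1))"
    using r mv by (rule reach_map)
  ultimately have "reach A p m (\<lambda>_. 0) (h (\<lambda>i. length (q i) - 1))"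
    by simp
  then show ?thesis
    by (subst feasible_iff_reach) (auto simp: h_def q_def pk n_def c_def)
qed

section \<open>Pattern reductions\<close>

text \<open>The other processes and the index set are arbitrary, so that replacements can be
  chained. Equal first and last elements are recorded because the algorithm sums those of the
  original processes, whereas peaks are removed from the reduced ones.\<close>

definition interchangeable :: "nat list \<Rightarrow> nat list \<Rightarrow> bool" where
  "interchangeable P Q \<longleftrightarrow> P \<noteq> [] \<and> Q \<noteq> [] \<and> hd P = hd Q \<and> last P = last Q \<and>
     (\<forall>A p m k. k \<in> A \<longrightarrow> p k = P \<longrightarrow> (feasible A p m \<longleftrightarrow> feasible A (p(k := Q)) m))"

lemma interchangeableI:
  assumes "P \<noteq> []" "Q \<noteq> []" "hd P = hd Q" "last P = last Q"
    and "\<And>A p m k. k \<in> A \<Longrightarrow> p k = P \<Longrightarrow> feasible A p m \<longleftrightarrow> feasible A (p(k := Q)) m"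
  shows "interchangeable P Q"
  using assms unfolding interchangeable_def by blast

lemma interchangeableD:
  assumes "interchangeable P Q"
  shows "P \<noteq> []" "Q \<noteq> []" "hd P = hd Q" "last P = last Q"
    and "\<And>A p m k. k \<in> A \<Longrightarrow> p k = P \<Longrightarrow> feasible A p m \<longleftrightarrow> feasible A (p(k := Q)) m"
  using assms unfolding interchangeable_def by blast+

lemma interchangeable_refl: "P \<noteq> [] \<Longrightarrow> interchangeable P P"
  by (auto simp: interchangeable_def)

lemma interchangeable_trans:
  assumes "interchangeable P Q" "interchangeable Q R"
  shows "interchangeable P R"
proof (rule interchangeableI)
  fix A p m and k :: nat
  assume k: "k \<in> A" "p k = P"
  have "feasible A p m \<longleftrightarrow> feasible A (p(k := Q)) m"
    using interchangeableD(5)[OF assms(1)] k by blast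
  also have "\<dots> \<longleftrightarrow> feasible A ((p(k := Q))(k := R)) m"
    by (rule interchangeableD(5)[OF assms(2)]) (use k in auto)
  finally show "feasible A p m \<longleftrightarrow> feasible A (p(k := R)) m"
    by simp
qed (use interchangeableD(1-4)[OF assms(1)] interchangeableD(1-4)[OF assms(2)] in simp_all)

lemma interchangeable_rev:
  assumes "interchangeable P Q"
  shows "interchangeable (rev P) (rev Q)"
proof (rule interchangeableI)
  fix A p m and k :: nat
  assume k: "k \<in> A" "p k = rev P"
  let ?r = "\<lambda>i. rev (p i)"
  have "feasible A ?r m \<longleftrightarrow> feasible A (?r(k := Q)) m"
    by (rule interchangeableD(5)[OF assms]) (use k in auto)
  moreover have "(\<lambda>i. rev ((?r(k := Q)) i)) = p(k := rev Q)"
    by auto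
  ultimately show "feasible A p m \<longleftrightarrow> feasible A (p(k := rev Q)) m"
    by (metis feasible_rev)
qed (use interchangeableD(1-4)[OF assms] in \<open>auto simp: hd_rev last_rev\<close>)

text \<open>The two directions have different causes: \<open>dominates\<close> translates paths when
  \<open>ys\<close> is dropped, and the bound by \<open>x\<close> permits
  \<open>feasible_insert\<close> for the way back.\<close>

lemma interchangeable_insert:
  assumes "\<forall>y\<in>set ys. y \<le> x" "dominates (xs @ x # ys @ zs) (xs @ x # zs)"
    and "last (x # ys @ zs) = last (x # zs)"
  shows "interchangeable (xs @ x # ys @ zs) (xs @ x # zs)"
proof (rule interchangeableI)
  fix A p m and k :: nat
  assume k: "k \<in> A" "p k = xs @ x # ys @ zs"
  show "feasible A p m \<longleftrightarrow> feasible A (p(k := xs @ x # zs)) m"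
  proof
    assume "feasible A p m"
    then show "feasible A (p(k := xs @ x # zs)) m"
      by (rule feasible_dominates) (use k assms(2) dominates_refl in auto)
  next
    assume "feasible A (p(k := xs @ x # zs)) m"
    then show "feasible A p m"
      using feasible_insert[of k A p xs x ys zs m] k assms(1) by blast
  qed
qed (use assms(3) in \<open>auto simp: hd_append\<close>)

text \<open>While the longer process is somewhere in \<open>ys\<close>, the shorter one already
  waits at \<open>z\<close>, which is no higher. One element in \<open>ys\<close> is the case of
  \<open>M2\<close>, two are the case of \<open>M3\<close>.\<close>

lemma interchangeable_descending:
  assumes "\<forall>y\<in>set ys. z \<le> y \<and> y \<le> x"
  shows "interchangeable (xs @ x # ys @ z # zs) (xs @ x # z # zs)"
proof (rule interchangeable_insert)
  let ?n = "length xs" and ?c = "length ys"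
  let ?f = "\<lambda>j. if j \<le> ?n then j else if j \<le> ?n + ?c then Suc ?n else j - ?c"
  let ?P = "xs @ x # ys @ z # zs" and ?Q = "xs @ x # z # zs"
  have val: "?Q ! ?f j \<le> ?P ! j" if j: "j < length ?P" for j
  proof -
    consider "j < ?n" | "j = ?n" | e where "e < ?c" "j = ?n + Suc e" | e where "j = ?n + Suc (?c + e)"
    proof -
      have "j < ?n \<or> j = ?n \<or> (\<exists>e<?c. j = ?n + Suc e) \<or> (\<exists>e. j = ?n + Suc (?c + e))"
        by presburger
      then show thesis
        using that by blast
    qed
    then show ?thesis
    proof cases
      case 3
      then show ?thesis
        using assms by (auto simp: nth_append)
    qed (auto simp: nth_append)
  qed
  show "dominates ?P ?Q"
    unfolding dominates_def
  proof (intro exI[of _ ?f] conjI)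
    show "\<forall>j<length ?P. ?f j < length ?Q \<and> ?Q ! ?f j \<le> ?P ! j"
    proof (intro allI impI conjI)
      fix j assume j: "j < length ?P"
      then show "?f j < length ?Q"
        by auto
      show "?Q ! ?f j \<le> ?P ! j"
        using j by (rule val)
    qed
  qed auto
qed (use assms in auto)

text \<open>\<open>M0\<close> may match at the last two elements, where no closing element
  \<open>z\<close> follows, so this is not an instance of the descending case.\<close>

lemma interchangeable_duplicate: "interchangeable (xs @ x # x # zs) (xs @ x # zs)"
proof -
  let ?n = "length xs"
  let ?f = "\<lambda>j. if j \<le> ?n then j else j - 1"
  let ?P = "xs @ x # x # zs" and ?Q = "xs @ x # zs"
  have val: "?Q ! ?f j \<le> ?P ! j" if "j < length ?P" for j
  proof -
    consider "j < ?n" | "j = ?n" | "j = Suc ?n" | e where "j = ?n + Suc (Suc e)"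
    proof -
      have "j < ?n \<or> j = ?n \<or> j = Suc ?n \<or> (\<exists>e. j = ?n + Suc (Suc e))"
        by presburger
      then show thesis
        using that by blast
    qed
    then show ?thesis
      by cases (auto simp: nth_append)
  qed
  have "dominates (xs @ x # [x] @ zs) ?Q"
    unfolding dominates_def
  proof (intro exI[of _ ?f] conjI)
    show "\<forall>j<length (xs @ x # [x] @ zs). ?f j < length ?Q \<and> ?Q ! ?f j \<le> (xs @ x # [x] @ zs) ! j"
    proof (intro allI impI conjI)
      fix j assume j: "j < length (xs @ x # [x] @ zs)"
      then show "?f j < length ?Q"
        by auto
      show "?Q ! ?f j \<le> (xs @ x # [x] @ zs) ! j"
        using val[of j] j by simp
    qed
  qed auto
  then show ?thesis
    using interchangeable_insert[of "[x]" x xs zs] by simp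
qed

text \<open>Mirror image of the descending case; it serves \<open>M1\<close> and
  \<open>M4\<close>.\<close>

lemma interchangeable_ascending:
  assumes "\<forall>y\<in>set ys. x \<le> y \<and> y \<le> z"
  shows "interchangeable (xs @ x # ys @ z # zs) (xs @ x # z # zs)"
  using interchangeable_rev[OF interchangeable_descending[of "rev ys" x z "rev zs" "rev xs"]] assms
  by simp

definition pattern_at :: "nat list \<Rightarrow> nat \<Rightarrow> bool" where
  "pattern_at a i \<longleftrightarrow> M0 a i \<or> M1 a i \<or> M2 a i \<or> M3 a i \<or> M4 a i"

lemmas pattern_defs = M0_def M1_def M2_def M3_def M4_def

lemma interchangeable_remove1:
  assumes "M0 a i \<or> M1 a i \<or> M2 a i"
  shows "interchangeable a (take (i+1) a @ drop (i+2) a)"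
proof -
  have i: "Suc i < length a"
    using assms by (auto simp: pattern_defs)
  have t: "take (i+1) a = take i a @ [a ! i]"
    using i by (simp add: take_Suc_conv_app_nth)
  have a: "a = take i a @ a ! i # a ! (i+1) # drop (i+2) a"
    using i id_take_nth_drop[of i a] Cons_nth_drop_Suc[of "Suc i" a] by simp
  show ?thesis
  proof (cases "M0 a i")
    case True
    then have "interchangeable (take i a @ a ! i # a ! (i+1) # drop (i+2) a)
        (take i a @ a ! i # drop (i+2) a)"
      using interchangeable_duplicate by (simp add: M0_def)
    with a t show ?thesis
      by simp
  next
    case False
    then have len: "i + 2 < length a"
      using assms by (auto simp: pattern_defs)
    then have d: "drop (i+2) a = a ! (i+2) # drop (i+3) a"
      using Cons_nth_drop_Suc[of "i+2" a] by (simp add: numeral_3_eq_3)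
    have "interchangeable (take i a @ a ! i # [a ! (i+1)] @ a ! (i+2) # drop (i+3) a)
        (take i a @ a ! i # a ! (i+2) # drop (i+3) a)"
    proof (cases "M1 a i")
      case True
      show ?thesis
        by (rule interchangeable_ascending) (use True in \<open>simp add: M1_def\<close>)
    next
      case F: False
      show ?thesis
        by (rule interchangeable_descending) (use F False assms in \<open>simp add: M2_def\<close>)
    qed
    with a t d show ?thesis
      by simp
  qed
qed

lemma interchangeable_remove2:
  assumes "M3 a i \<or> M4 a i"
  shows "interchangeable a (take (i+1) a @ drop (i+3) a)"
proof -
  have i: "i + 3 < length a"
    using assms by (auto simp: pattern_defs)
  have t: "take (i+1) a = take i a @ [a ! i]"
    using i by (simp add: take_Suc_conv_app_nth)
  have d: "drop (i+3) a = a ! (i+3) # drop (i+4) a"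
    using i Cons_nth_drop_Suc[of "i+3" a] by (simp add: eval_nat_numeral)
  have a: "a = take i a @ a ! i # [a ! (i+1), a ! (i+2)] @ a ! (i+3) # drop (i+4) a"
    using i id_take_nth_drop[of i a] Cons_nth_drop_Suc[of "i+1" a] Cons_nth_drop_Suc[of "i+2" a] d
    by (simp add: eval_nat_numeral)
  have "interchangeable (take i a @ a ! i # [a ! (i+1), a ! (i+2)] @ a ! (i+3) # drop (i+4) a)
        (take i a @ a ! i # a ! (i+3) # drop (i+4) a)"
  proof (cases "M3 a i")
    case True
    show ?thesis
      by (rule interchangeable_descending) (use True in \<open>auto simp: M3_def\<close>)
  next
    case False
    show ?thesis
      by (rule interchangeable_ascending) (use False assms in \<open>auto simp: M4_def\<close>)
  qed
  with a t d show ?thesis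
    by simp
qed

lemma interchangeable_reduce_step:
  assumes "a \<noteq> []"
  shows "interchangeable a (fst (reduce_step (a, i)))"
  using assms interchangeable_remove1[of a i] interchangeable_remove2[of a i]
  by (auto simp: reduce_step_def interchangeable_refl)

section \<open>Correctness and termination of the reduction loop\<close>

lemma pattern_at_append:
  assumes "j + 3 < length b"
  shows "pattern_at (b @ c) j \<longleftrightarrow> pattern_at b j"
  using assms by (auto simp: pattern_at_def pattern_defs nth_append)

lemma pattern_at_take:
  assumes "j + 3 < i" "i \<le> length a"
  shows "pattern_at (take i a @ c) j \<longleftrightarrow> pattern_at a j"
  using assms pattern_at_append[of j "take i a" c] pattern_at_append[of j "take i a" "drop i a"]
  by simp

text \<open>A pattern at \<open>j\<close> reads no element beyond \<open>j + 3\<close>, and a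
  reduction at \<open>i\<close> leaves the elements up to \<open>i\<close> in place. Hence the
  indices below \<open>i - 3\<close> remain free of patterns, which is why going back by three
  suffices.\<close>

lemma reduce_step_pattern_free:
  assumes "\<forall>j<i. \<not> pattern_at a j" "i < length a" "reduce_step (a, i) = (b, k)"
  shows "\<forall>j<k. \<not> pattern_at b j"
proof (cases "pattern_at a i")
  case True
  then obtain c where "b = take (i+1) a @ c" "k = i - 3"
    using assms(3) by (auto simp: reduce_step_def pattern_at_def split: if_splits)
  then show ?thesis
    using assms(1,2) pattern_at_take[of _ "i+1" a c] by auto
next
  case False
  then have "b = a" "k = i + 1"
    using assms(3) by (auto simp: reduce_step_def pattern_at_def split: if_splits)
  with False assms(1) show ?thesis
    by (auto simp: less_Suc_eq)
qed

text \<open>A reduction deletes at least one element and moves the index back by at most three; the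
  factor 4 makes the deletion outweigh this.\<close>

lemma reduce_step_measure:
  assumes "i < length a" "reduce_step (a, i) = (b, k)"
  shows "4 * length b - k < 4 * length a - i"
proof -
  have "Suc i < length a" if "M0 a i \<or> M1 a i \<or> M2 a i"
    using that by (auto simp: pattern_defs)
  moreover have "i + 3 < length a" if "M3 a i \<or> M4 a i"
    using that by (auto simp: pattern_defs)
  ultimately show ?thesis
    using assms by (auto simp: reduce_step_def split: if_splits)
qed

lemma reduce_correct:
  assumes "P \<noteq> []"
  shows "\<exists>Q. reduce P = Some Q \<and> interchangeable P Q \<and> (\<forall>i. \<not> pattern_at Q i)"
proof -
  let ?b = "\<lambda>(a, i). i < length (a :: nat list)"
  let ?I = "\<lambda>(a, i). interchangeable P a \<and> (\<forall>j<i. \<not> pattern_at a j)"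
  have inv: "?I (reduce_step x)" if "?I x" "?b x" for x
  proof -
    obtain a i where x: "x = (a, i)"
      by fastforce
    obtain b k where s: "reduce_step (a, i) = (b, k)"
      by fastforce
    have "interchangeable P a"
      using that(1) x by simp
    then have "interchangeable P b"
      using interchangeable_reduce_step[of a i] interchangeable_trans s interchangeableD(2)
      by (metis fst_conv)
    then show ?thesis
      using reduce_step_pattern_free[of i a b k] that x s by simp
  qed
  have "\<exists>y. while_option ?b reduce_step (P, 0) = Some y"
  proof (rule measure_while_option_Some[where P = "\<lambda>_. True" and f = "\<lambda>(a, i). 4 * length a - i"])
    fix x :: "nat list \<times> nat"
    assume "?b x"
    then show "True \<and> (case reduce_step x of (a, i) \<Rightarrow> 4 * length a - i)
        < (case x of (a, i) \<Rightarrow> 4 * length a - i)"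
      using reduce_step_measure by (cases x; cases "reduce_step x") auto
  qed simp
  then obtain Q i where Q: "while_option ?b reduce_step (P, 0) = Some (Q, i)"
    by auto
  have "?I (Q, i)"
    using while_option_rule[of ?I ?b reduce_step "(P, 0)" "(Q, i)"] inv Q
      interchangeable_refl[OF assms] by auto
  \<comment> \<open>The loop ends beyond the last index, where no pattern can match, so the
    invariant excludes all patterns.\<close>
  moreover have "\<not> i < length Q"
    using while_option_stop[OF Q] by simp
  moreover have "j < length Q" if "pattern_at Q j" for j
    using that by (auto simp: pattern_at_def pattern_defs)
  ultimately show ?thesis
    using Q by (fastforce simp: reduce_def)
qed

text \<open>At each stage of the replacement the family is a mixture of old and new processes, which
  \<open>interchangeable\<close> allows.\<close>

lemma feasible_interchangeable:
  assumes "finite A" "\<And>i. i \<in> A \<Longrightarrow> interchangeable (p i) (q i)"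
  shows "feasible A p m \<longleftrightarrow> feasible A q m"
proof -
  have "feasible A p m \<longleftrightarrow> feasible A (\<lambda>i. if i \<in> B then q i else p i) m" if "B \<subseteq> A" for B
    using finite_subset[OF that assms(1)] that
  proof (induction B)
    case (insert b B)
    let ?r = "\<lambda>i. if i \<in> B then q i else p i"
    have "feasible A ?r m \<longleftrightarrow> feasible A (?r(b := q b)) m"
      using interchangeableD(5)[OF assms(2)[of b], of b A ?r m] insert by auto
    moreover have "?r(b := q b) = (\<lambda>i. if i \<in> insert b B then q i else p i)"
      by auto
    ultimately show ?case
      using insert by auto
  qed auto
  from this[of A] show ?thesis
    using feasible_cong[of A "\<lambda>i. if i \<in> A then q i else p i" q m] by auto
qed

section \<open>Removal of peaks and of one-element processes\<close>

text \<open>All start-peaks are left in one joint first move, so the only expense beyond that of the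
  shortened processes is the initial position itself.\<close>

lemma feasible_remove_start_peak:
  assumes "\<And>i. i \<in> A \<Longrightarrow> p i \<noteq> []"
  shows "feasible A p m \<longleftrightarrow>
    (\<Sum>i\<in>A. hd (p i)) \<le> m \<and> feasible A (\<lambda>i. remove_start_peak (p i)) m"
proof -
  define c where "c = (\<lambda>i. if length (p i) \<ge> 2 \<and> p i ! 0 \<ge> p i ! 1 then 1 else 0 :: nat)"
  let ?q = "\<lambda>i. remove_start_peak (p i)"
  have q: "?q i = drop (c i) (p i)" for i
    by (simp add: c_def remove_start_peak_def drop_Suc)
  have c: "c i < length (p i)" if "i \<in> A" for i
    using assms[OF that] by (simp add: c_def)
  have adm0: "admissible A p m (\<lambda>_. 0) \<longleftrightarrow> (\<Sum>i\<in>A. hd (p i)) \<le> m"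
    using assms by (auto simp: admissible_def cost_def hd_conv_nth)
  have dom: "dominates (p i) (?q i)" if "i \<in> A" for i
    unfolding dominates_def
  \<comment> \<open>Truncated subtraction sends a peak and its successor both to position 0 of the
    shortened process, whose value is no higher than either.\<close>
  proof (intro exI[of _ "\<lambda>j. j - c i"] conjI allI impI)
    fix j assume "j < length (p i)"
    then show "j - c i < length (?q i)"
      using c[OF that] by (auto simp: q)
    show "?q i ! (j - c i) \<le> p i ! j"
      using c[OF that] \<open>j < length (p i)\<close> by (cases j) (auto simp: q c_def)
  qed (use c[OF that] in \<open>auto simp: q\<close>)
  let ?h = "\<lambda>s i. s i + c i"
  have adm: "admissible A p m (?h s)" if "admissible A ?q m s" for s
    by (rule admissible_mono[OF that]) (auto simp: q add.commute)
  have mv: "reach A p m (?h u) (?h v)" if "move A ?q m u v" for u v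
  proof -
    have "move A p m (?h u) (?h v)"
      using that adm by (auto simp: move_def)
    then show ?thesis
      by blast
  qed
  show ?thesis
  proof (intro iffI conjI)
    assume "feasible A p m"
    then show "feasible A ?q m"
      using dom by (rule feasible_dominates)
    show "(\<Sum>i\<in>A. hd (p i)) \<le> m"
      using reach_admissible(1) \<open>feasible A p m\<close> adm0 unfolding feasible_def by blast
  next
    assume *: "(\<Sum>i\<in>A. hd (p i)) \<le> m \<and> feasible A ?q m"
    then have r: "reach A p m (?h (\<lambda>_. 0)) (?h (\<lambda>i. length (?q i) - 1))"
      using reach_map[of A ?q m _ _ A p m ?h] mv unfolding feasible_def by blast
    have "move A p m (\<lambda>_. 0) (?h (\<lambda>_. 0))"
      using * adm0 reach_admissible(1)[OF r] by (auto simp: move_def c_def)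
    with r have "reach A p m (\<lambda>_. 0) (?h (\<lambda>i. length (?q i) - 1))"
      by (meson tranclp_into_tranclp2)
    moreover have "length (p i) - Suc (c i) + c i = length (p i) - Suc 0" if "i \<in> A" for i
      using c[OF that] by linarith
    ultimately show "feasible A p m"
      by (subst feasible_iff_reach) (auto simp: q)
  qed
qed

lemma remove_end_peak_rev: "remove_end_peak a = rev (remove_start_peak (rev a))"
proof (cases "length a \<ge> 2")
  case True
  then have "rev a ! 0 = a ! (length a - 1)" "rev a ! 1 = a ! (length a - 2)"
    by (subst rev_nth; auto simp: numeral_2_eq_2)+
  with True show ?thesis
    using butlast_rev[of "rev a"]
    by (auto simp: remove_end_peak_def remove_start_peak_def)
qed (simp add: remove_end_peak_def remove_start_peak_def)

lemma feasible_remove_end_peak: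
  assumes "\<And>i. i \<in> A \<Longrightarrow> p i \<noteq> []"
  shows "feasible A p m \<longleftrightarrow>
    (\<Sum>i\<in>A. last (p i)) \<le> m \<and> feasible A (\<lambda>i. remove_end_peak (p i)) m"
  using feasible_remove_start_peak[of A "\<lambda>i. rev (p i)" m] assms
    feasible_rev[of A p m] feasible_rev[of A "\<lambda>i. remove_start_peak (rev (p i))" m]
  by (simp add: remove_end_peak_rev hd_rev)

text \<open>A one-element process contributes the same value at every moment, so it only lowers the
  budget. The conjunct comparing the total with \<open>m\<close> guards the truncated
  subtraction.\<close>

lemma feasible_remove_singletons:
  assumes "finite A" "\<And>i. i \<in> A - B \<Longrightarrow> length (p i) = 1" "B \<subseteq> A"
  shows "feasible A p m \<longleftrightarrow>
    (\<Sum>i\<in>A-B. p i ! 0) \<le> m \<and> feasible B p (m - (\<Sum>i\<in>A-B. p i ! 0))"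
proof -
  let ?c = "\<Sum>i\<in>A-B. p i ! 0"
  have cost: "cost A p s = ?c + cost B p s" if "\<And>i. i \<in> A - B \<Longrightarrow> s i = 0" for s
    using that assms sum.subset_diff[OF assms(3,1), of "\<lambda>i. p i ! s i"] by (simp add: cost_def)
  have adm: "admissible A p m s \<longleftrightarrow> (\<forall>i\<in>A-B. s i = 0) \<and> ?c \<le> m \<and> admissible B p (m - ?c) s" for s
  proof (cases "\<forall>i\<in>A-B. s i = 0")
    case True
    then show ?thesis
      using cost[of s] assms by (auto simp: admissible_def)
  next
    case False
    then show ?thesis
      using assms by (fastforce simp: admissible_def)
  qed
  \<comment> \<open>Paths over \<open>B\<close> say nothing about positions outside
    \<open>B\<close>, so these are reset to 0, the only position of a one-element process.\<close>
  let ?h = "\<lambda>s i. if i \<in> B then s i else 0"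
  have admB: "admissible B p k (?h s) \<longleftrightarrow> admissible B p k s" for k s
    by (rule admissible_cong) auto
  show ?thesis
  proof (intro iffI conjI)
    assume A: "feasible A p m"
    then show "?c \<le> m"
      using reach_admissible(1) adm unfolding feasible_def by blast
    show "feasible B p (m - ?c)"
      unfolding feasible_def
    proof (rule reach_map[OF A[unfolded feasible_def], where h = "\<lambda>s. s"])
      fix u v assume "move A p m u v"
      then have "move B p (m - ?c) u v"
        using assms(3) by (auto simp: move_def adm)
      then show "reach B p (m - ?c) u v"
        by blast
    qed
  next
    assume B: "?c \<le> m \<and> feasible B p (m - ?c)"
    then have "reach B p (m - ?c) (\<lambda>_. 0) (\<lambda>i. length (p i) - 1)"
      by (simp add: feasible_def)
    then have "reach A p m (?h (\<lambda>_. 0)) (?h (\<lambda>i. length (p i) - 1))"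
    proof (rule reach_map)
      fix u v assume "move B p (m - ?c) u v"
      then have "move A p m (?h u) (?h v)"
        using B by (auto simp: move_def adm admB)
      then show "reach A p m (?h u) (?h v)"
        by blast
    qed
    then show "feasible A p m"
      by (subst feasible_iff_reach) (use assms in auto)
  qed
qed

text \<open>Filtering out processes renumbers the others; feasibility does not depend on the names
  of the indices.\<close>

lemma feasible_reindex:
  assumes "bij_betw h B A"
  shows "feasible A p m \<longleftrightarrow> feasible B (\<lambda>j. p (h j)) m"
proof -
  have adm: "admissible A p m s \<longleftrightarrow> admissible B (\<lambda>j. p (h j)) m (\<lambda>j. s (h j))" for s
    using sum.reindex_bij_betw[OF assms, of "\<lambda>i. p i ! s i"] bij_betw_imp_surj_on[OF assms]
    by (auto simp: admissible_def cost_def)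
  have adm': "admissible B (\<lambda>j. p (h j)) m s \<longleftrightarrow> admissible A p m (\<lambda>i. s (inv_into B h i))" for s
    unfolding adm using bij_betw_inv_into_left[OF assms] by (intro admissible_cong) auto
  show ?thesis
  proof
    assume "feasible A p m"
    then have "reach B (\<lambda>j. p (h j)) m (\<lambda>j. 0) (\<lambda>j. length (p (h j)) - 1)"
      unfolding feasible_def
    proof (rule reach_map[where h = "\<lambda>s j. s (h j)"])
      fix u v assume "move A p m u v"
      then have "move B (\<lambda>j. p (h j)) m (\<lambda>j. u (h j)) (\<lambda>j. v (h j))"
        using adm bij_betw_imp_surj_on[OF assms] by (auto simp: move_def)
      then show "reach B (\<lambda>j. p (h j)) m (\<lambda>j. u (h j)) (\<lambda>j. v (h j))"
        by blast
    qed
    then show "feasible B (\<lambda>j. p (h j)) m"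
      by (simp add: feasible_def)
  next
    assume "feasible B (\<lambda>j. p (h j)) m"
    then have "reach A p m (\<lambda>i. 0) (\<lambda>i. length (p (h (inv_into B h i))) - 1)"
      unfolding feasible_def
    proof (rule reach_map[where h = "\<lambda>s i. s (inv_into B h i)"])
      fix u v assume "move B (\<lambda>j. p (h j)) m u v"
      then have "move A p m (\<lambda>i. u (inv_into B h i)) (\<lambda>i. v (inv_into B h i))"
        using adm' bij_betw_imp_surj_on[OF assms] by (fastforce simp: move_def inv_into_into)
      then show "reach A p m (\<lambda>i. u (inv_into B h i)) (\<lambda>i. v (inv_into B h i))"
        by blast
    qed
    then show "feasible A p m"
      by (subst feasible_iff_reach) (use bij_betw_inv_into_right[OF assms] in auto)
  qed
qed

section \<open>The shape of standardized processes\<close>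

text \<open>Read backwards, \<open>M1\<close> and \<open>M2\<close> exchange roles, likewise
  \<open>M3\<close> and \<open>M4\<close>, and \<open>M0\<close> is its own mirror image.\<close>

lemma pattern_at_rev:
  assumes "pattern_at (rev a) i"
  shows "\<exists>j. pattern_at a j"
proof -
  let ?n = "length a"
  have nth: "rev a ! (i + d) = a ! (?n - Suc (i + d))" if "i + d < ?n" for d
    using that by (simp add: rev_nth)
  have n0: "rev a ! i = a ! (?n - Suc i)" if "i < ?n"
    using that by (simp add: rev_nth)
  consider "M0 (rev a) i" | "M1 (rev a) i" | "M2 (rev a) i" | "M3 (rev a) i" | "M4 (rev a) i"
    using assms by (auto simp: pattern_at_def)
  then show ?thesis
  proof cases
    case 1
    then obtain j where "?n = i + 2 + j"
      by (auto simp: M0_def dest!: less_imp_Suc_add)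
    with 1 have "M0 a j"
      using nth[of 1] n0 by (auto simp: M0_def)
    then show ?thesis
      by (auto simp: pattern_at_def)
  next
    case 2
    then obtain j where "?n = i + 3 + j"
      by (auto simp: M1_def dest!: less_imp_Suc_add)
    with 2 have "M2 a j"
      using nth[of 1] nth[of 2] n0 by (auto simp: pattern_defs eval_nat_numeral)
    then show ?thesis
      by (auto simp: pattern_at_def)
  next
    case 3
    then obtain j where "?n = i + 3 + j"
      by (auto simp: M2_def dest!: less_imp_Suc_add)
    with 3 have "M1 a j"
      using nth[of 1] nth[of 2] n0 by (auto simp: pattern_defs eval_nat_numeral)
    then show ?thesis
      by (auto simp: pattern_at_def)
  next
    case 4
    then obtain j where "?n = i + 4 + j"
      by (auto simp: M3_def dest!: less_imp_Suc_add)
    with 4 have "M4 a j"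
      using nth[of 1] nth[of 2] nth[of 3] n0 by (auto simp: pattern_defs eval_nat_numeral)
    then show ?thesis
      by (auto simp: pattern_at_def)
  next
    case 5
    then obtain j where "?n = i + 4 + j"
      by (auto simp: M4_def dest!: less_imp_Suc_add)
    with 5 have "M3 a j"
      using nth[of 1] nth[of 2] nth[of 3] n0 by (auto simp: pattern_defs eval_nat_numeral)
    then show ?thesis
      by (auto simp: pattern_at_def)
  qed
qed

lemma pattern_at_tl:
  assumes "pattern_at (tl a) i"
  shows "pattern_at a (Suc i)"
  using assms by (cases a) (simp_all add: pattern_at_def pattern_defs add.commute)

lemma pattern_at_remove_start_peak:
  assumes "pattern_at (remove_start_peak a) i"
  shows "\<exists>j. pattern_at a j"
  using assms pattern_at_tl[of a i] by (auto simp: remove_start_peak_def split: if_splits)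

lemma remove_start_peak_eq_Nil [simp]: "remove_start_peak a = [] \<longleftrightarrow> a = []"
  by (cases a) (auto simp: remove_start_peak_def)

text \<open>A single element qualifies, so the notion applies already before the one-element
  processes are filtered out.\<close>

definition zigzag :: "nat list \<Rightarrow> bool" where
  "zigzag a \<longleftrightarrow> a \<noteq> [] \<and> (\<forall>i. \<not> pattern_at a i) \<and>
     (length a \<ge> 2 \<longrightarrow> a ! 0 < a ! 1 \<and> a ! (length a - 1) < a ! (length a - 2))"

lemma zigzag_rev:
  assumes "zigzag a"
  shows "zigzag (rev a)"
proof -
  have "rev a ! 0 = a ! (length a - 1)" "rev a ! 1 = a ! (length a - 2)"
    "rev a ! (length a - 1) = a ! 0" "rev a ! (length a - 2) = a ! 1" if "length a \<ge> 2"
    using that by (subst rev_nth; auto simp: numeral_2_eq_2)+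
  then show ?thesis
    using assms pattern_at_rev[of a] by (auto simp: zigzag_def)
qed

text \<open>One removal at each end suffices: if the new first element were again no smaller than
  its neighbour, \<open>M2\<close> would match at the old beginning. Removing the end-peak leaves
  the beginning intact as long as two elements remain.\<close>

lemma zigzag_remove_peaks:
  assumes "a \<noteq> []" "\<And>i. \<not> pattern_at a i"
  shows "zigzag (remove_end_peak (remove_start_peak a))"
proof -
  define b where "b = remove_start_peak a"
  \<comment> \<open>\<open>c\<close> is the mirror image of the standardized process: its start is
    the end of that process.\<close>
  define c where "c = remove_start_peak (rev b)"
  have pa: "\<not> pattern_at b i" for i
    using assms pattern_at_remove_start_peak b_def by blast
  have pb: "\<not> pattern_at (rev b) i" for i
    using pa pattern_at_rev by blast
  have pc: "\<not> pattern_at c i" for i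
    using pb pattern_at_remove_start_peak c_def by blast
  have start: "x ! 0 < x ! 1" if "x = remove_start_peak y" "\<And>i. \<not> pattern_at y i" "length x \<ge> 2"
    for x y
  proof (cases "length y \<ge> 2 \<and> y ! 0 \<ge> y ! 1")
    case True
    then have "x = tl y"
      using that by (simp add: remove_start_peak_def)
    with True that(2)[of 0] that(3) show ?thesis
      by (auto simp: pattern_at_def M2_def nth_tl numeral_2_eq_2)
  next
    case False
    with that show ?thesis
      by (auto simp: remove_start_peak_def split: if_splits)
  qed
  have ne: "b \<noteq> []" "c \<noteq> []"
    using assms(1) by (auto simp: b_def c_def)
  have c_start: "c ! 0 < c ! 1" if "length c \<ge> 2"
    using start[OF c_def pb that] .
  have c_end: "c ! (length c - 1) < c ! (length c - 2)" if l: "length c \<ge> 2"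
  proof -
    have "length b \<ge> 2"
      using l by (auto simp: c_def remove_start_peak_def split: if_splits)
    then have "b ! 0 < b ! 1"
      using start[OF b_def assms(2)] by simp
    moreover obtain d where d: "c = drop d (rev b)" "length b = length c + d"
    proof (cases "c = rev b")
      case True
      with that[of 0] show thesis
        by simp
    next
      case False
      then have "c = tl (rev b)"
        by (auto simp: c_def remove_start_peak_def)
      with that[of 1] \<open>length b \<ge> 2\<close> show thesis
        by (simp add: drop_Suc)
    qed
    have "drop d (rev b) ! (length c - k) = rev b ! (length b - k)" if "k \<le> length c" for k
      using that by (simp add: d(2) add.commute)
    from this[of 1] this[of 2]
    have "c ! (length c - 1) = rev b ! (length b - 1)" "c ! (length c - 2) = rev b ! (length b - 2)"
      using l by (simp_all add: d(1)[symmetric])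
    moreover have "rev b ! (length b - 1) = b ! 0" "rev b ! (length b - 2) = b ! 1"
      using \<open>length b \<ge> 2\<close> by (subst rev_nth; auto simp: numeral_2_eq_2)+
    ultimately show ?thesis
      by simp
  qed
  have "zigzag c"
    using ne pc c_start c_end by (simp add: zigzag_def)
  then show ?thesis
    using zigzag_rev by (simp add: remove_end_peak_rev b_def c_def)
qed

text \<open>Without \<open>M0\<close>, \<open>M1\<close>, \<open>M2\<close>, two successive steps go
  in strictly opposite directions, and the first one goes up. So even indices are valleys and odd
  ones peaks, apart from the one-element case.\<close>

lemma zigzag_up_down:
  assumes "zigzag a" "Suc i < length a"
  shows "if even i then a ! i < a ! Suc i else a ! Suc i < a ! i"
  using assms(2)
proof (induction i)
  case 0
  with assms(1) show ?case
    by (auto simp: zigzag_def)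
next
  case (Suc i)
  then have "\<not> M0 a (Suc i)" "\<not> M1 a i" "\<not> M2 a i"
    using assms(1) by (auto simp: zigzag_def pattern_at_def)
  with Suc show ?case
    by (auto simp: pattern_defs split: if_splits)
qed

text \<open>The scan moves in strides of two from index 0, so it rests only at even indices up to
  \<open>e\<close>; each of these has to be the lowest value so far.\<close>

definition scannable :: "nat list \<Rightarrow> nat \<Rightarrow> bool" where
  "scannable a e \<longleftrightarrow> e < length a \<and> even e \<and>
     (\<forall>j. even j \<longrightarrow> j \<le> e \<longrightarrow> (\<forall>l\<le>j. a ! j \<le> a ! l))"

text \<open>
  If a valley were higher than the preceding one, then the absence of \<open>M3\<close> and \<open>M4\<close> would
  force all later peaks to decrease and all later valleys to increase.
\<close>

lemma zigzag_scannable: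
  assumes "zigzag a" "e < length a" "\<And>l. l < length a \<Longrightarrow> a ! e \<le> a ! l"
  shows "scannable a e"
proof -
  have up_down: "if even i then a ! i < a ! Suc i else a ! Suc i < a ! i" if "Suc i < length a" for i
    using zigzag_up_down[OF assms(1) that] .
  have free: "\<not> M3 a i" "\<not> M4 a i" for i
    using assms(1) by (auto simp: zigzag_def pattern_at_def)
  \<comment> \<open>An odd index is a peak, strictly above its left neighbour, so it cannot carry
    the minimum.\<close>
  have e: "even e"
  proof (rule ccontr)
    assume "odd e"
    then obtain d where "e = Suc d" "even d"
      by (cases e) auto
    with up_down[of d] assms(2) assms(3)[of d] show False
      by auto
  qed
  have valleys: "a ! (j + 2) \<le> a ! j" if j: "even j" "j + 2 \<le> e" for j
  proof (rule ccontr)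
    assume "\<not> a ! (j + 2) \<le> a ! j"
    then have start: "a ! j < a ! (j + 2)"
      by simp
    have incr: "a ! (j + 2 * k) < a ! (j + 2 * k + 2)" if "j + 2 * k + 2 < length a" for k
      using that
    proof (induction k)
      case 0
      with start show ?case
        by simp
    next
      case (Suc k)
      define i where "i = j + 2 * k"
      have l: "Suc (Suc (Suc (Suc i))) < length a" and "even i"
        using Suc.prems j(1) by (simp_all add: i_def)
      then have ud: "a ! i < a ! Suc i" "a ! Suc (Suc i) < a ! Suc i"
        "a ! Suc (Suc i) < a ! Suc (Suc (Suc i))"
        "a ! Suc (Suc (Suc (Suc i))) < a ! Suc (Suc (Suc i))"
        using up_down[of i] up_down[of "Suc i"] up_down[of "Suc (Suc i)"]
          up_down[of "Suc (Suc (Suc i))"] by simp_all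
      have "a ! i < a ! Suc (Suc i)"
        using Suc by (simp add: i_def)
      then have "a ! Suc (Suc (Suc i)) < a ! Suc i"
        using free(2)[of i] ud l by (simp add: M4_def not_le numeral_3_eq_3)
      then have "a ! Suc (Suc i) < a ! Suc (Suc (Suc (Suc i)))"
        using free(1)[of "Suc i"] ud l by (simp add: M3_def not_le numeral_3_eq_3)
      then show ?case
        by (simp add: i_def)
    qed
    \<comment> \<open>Once one valley rises, all later ones lie above \<open>a ! j\<close>, and so
      does \<open>a ! e\<close>, contrary to its minimality.\<close>
    have "a ! j < a ! (j + 2 * Suc k)" if "j + 2 * Suc k < length a" for k
      using that
    proof (induction k)
      case 0
      with start show ?case
        by simp
    next
      case (Suc k)
      then show ?case
        using incr[of "Suc k"] by simp
    qed
    moreover obtain k where "e = j + 2 * Suc k"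
    proof -
      have "even (e - j - 2)"
        using e j by simp
      then obtain k where "e - j - 2 = 2 * k"
        by blast
      with j show thesis
        using that[of k] by simp
    qed
    ultimately show False
      using assms(2) assms(3)[of j] by fastforce
  qed
  have "a ! j \<le> a ! l" if "even j" "j \<le> e" "l \<le> j" for j l
    using that
  proof (induction j arbitrary: l rule: less_induct)
    case (less j)
    show ?case
    proof (cases "l + 2 \<le> j")
      case True
      then have j: "even (j - 2)" "(j - 2) + 2 = j"
        using less.prems by auto
      have "a ! (j - 2) \<le> a ! l"
        by (rule less.IH) (use less.prems True in auto)
      moreover have "a ! j \<le> a ! (j - 2)"
        using valleys[OF j(1)] j less.prems by simp
      ultimately show ?thesis
        by simp
    next
      case False
      \<comment> \<open>Here \<open>l\<close> is \<open>j\<close> or the peak just before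
        it.\<close>
      with less.prems have "l = j \<or> (j = Suc l \<and> odd l)"
        by (cases "j = Suc l") auto
      then show ?thesis
        using up_down[of l] less.prems assms(2) by auto
    qed
  qed
  then show ?thesis
    using e assms(2) by (simp add: scannable_def)
qed

lemma rightmost_valley:
  assumes "a \<noteq> []"
  shows "rightmost_valley a < length a" "l < length a \<Longrightarrow> a ! rightmost_valley a \<le> a ! l"
proof -
  let ?S = "{i. i < length a \<and> a ! i = Min (set a)}"
  have "Min (set a) \<in> set a"
    using assms by simp
  then have "?S \<noteq> {}"
    by (auto simp: in_set_conv_nth)
  moreover have "finite ?S"
    by simp
  ultimately have "rightmost_valley a \<in> ?S"
    unfolding rightmost_valley_def by (rule Max_in[rotated])
  then show "rightmost_valley a < length a" "l < length a \<Longrightarrow> a ! rightmost_valley a \<le> a ! l"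
    by auto
qed

lemma scannable_left: "zigzag a \<Longrightarrow> scannable a (rightmost_valley a)"
  using rightmost_valley zigzag_scannable unfolding zigzag_def by metis

text \<open>Any occurrence of the minimum is acceptable to \<open>zigzag_scannable\<close>, so the
  same valley can serve as the stop of both scans.\<close>

lemma scannable_right: "zigzag a \<Longrightarrow> scannable (rev a) (length a - 1 - rightmost_valley a)"
proof -
  assume a: "zigzag a"
  then have "a \<noteq> []"
    by (simp add: zigzag_def)
  note v = rightmost_valley[OF this]
  have "rev a ! (length a - 1 - rightmost_valley a) = a ! rightmost_valley a"
    using v(1) by (simp add: rev_nth Suc_diff_Suc)
  with v show ?thesis
    by (intro zigzag_scannable[OF zigzag_rev[OF a]]) (auto simp: rev_nth)
qed

section \<open>The scan\<close>

text \<open>Both scans are instances, the right one with the reversed processes and mirrored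
  stops.\<close>

locale scan_problem =
  fixes Ps :: "nat list list" and ends :: "nat list"
  assumes scannable: "\<And>i. i < length Ps \<Longrightarrow> scannable (Ps ! i) (ends ! i)"
begin

definition prefix :: "nat \<Rightarrow> nat list" where
  "prefix i = take (Suc (ends ! i)) (Ps ! i)"

text \<open>The last two clauses are the two halves of optimality: \<open>M\<close> suffices to
  reach the present positions, and no feasible bound lies below \<open>M\<close>. Entries of
  \<open>T\<close> may also belong to processes that have reached their stop; only the unfinished
  ones must be there.\<close>

definition invariant :: "scan_state \<Rightarrow> bool" where
  "invariant = (\<lambda>(T, S, M, I, Qs). length I = length Ps \<and> length Qs = length Ps \<and>
     (\<forall>i<length Ps. even (I ! i) \<and> I ! i \<le> ends ! i \<and> Qs ! i = drop (I ! i) (Ps ! i)) \<and>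
     finite T \<and>
     (\<forall>(d, i)\<in>T. i < length Ps \<and> d = int (Qs ! i ! 1) - int (Qs ! i ! 0)) \<and>
     (\<forall>i<length Ps. I ! i < ends ! i \<longrightarrow> i \<in> snd ` T) \<and>
     S = (\<Sum>i<length Ps. int (Ps ! i ! (I ! i))) \<and> S \<le> M \<and>
     (\<forall>m. M \<le> int m \<longrightarrow> reach {..<length Ps} prefix m (\<lambda>_. 0) ((!) I)) \<and>
     (\<forall>m. feasible {..<length Ps} prefix m \<longrightarrow> M \<le> int m))"

lemma invariantD:
  assumes "invariant (T, S, M, I, Qs)"
  shows "length I = length Ps" "length Qs = length Ps"
    and "\<And>i. i < length Ps \<Longrightarrow> even (I ! i)" "\<And>i. i < length Ps \<Longrightarrow> I ! i \<le> ends ! i"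
    and "\<And>i. i < length Ps \<Longrightarrow> Qs ! i = drop (I ! i) (Ps ! i)"
    and "finite T"
    and "\<And>d i. (d, i) \<in> T \<Longrightarrow> i < length Ps \<and> d = int (Qs ! i ! 1) - int (Qs ! i ! 0)"
    and "\<And>i. i < length Ps \<Longrightarrow> I ! i < ends ! i \<Longrightarrow> i \<in> snd ` T"
    and "S = (\<Sum>i<length Ps. int (Ps ! i ! (I ! i)))" "S \<le> M"
    and "\<And>m. M \<le> int m \<Longrightarrow> reach {..<length Ps} prefix m (\<lambda>_. 0) ((!) I)"
    and "\<And>m. feasible {..<length Ps} prefix m \<Longrightarrow> M \<le> int m"
  using assms unfolding invariant_def by auto

lemma ends_less: "i < length Ps \<Longrightarrow> ends ! i < length (Ps ! i)"
  using scannable by (simp add: scannable_def)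

lemma length_prefix: "i < length Ps \<Longrightarrow> length (prefix i) = Suc (ends ! i)"
  using ends_less[of i] by (simp add: prefix_def)

lemma nth_prefix: "j \<le> ends ! i \<Longrightarrow> prefix i ! j = Ps ! i ! j"
  by (simp add: prefix_def)

lemma admissible_prefix:
  "admissible {..<length Ps} prefix m s \<longleftrightarrow>
     (\<forall>i<length Ps. s i \<le> ends ! i) \<and> (\<Sum>i<length Ps. int (Ps ! i ! s i)) \<le> int m"
proof (cases "\<forall>i<length Ps. s i \<le> ends ! i")
  case True
  then have "int (cost {..<length Ps} prefix s) = (\<Sum>i<length Ps. int (Ps ! i ! s i))"
    by (simp add: cost_def nth_prefix)
  then have "cost {..<length Ps} prefix s \<le> m \<longleftrightarrow> (\<Sum>i<length Ps. int (Ps ! i ! s i)) \<le> int m"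
    by linarith
  with True show ?thesis
    by (simp add: admissible_def length_prefix less_Suc_eq_le)
next
  case False
  then show ?thesis
    by (auto simp: admissible_def length_prefix less_Suc_eq_le)
qed

lemma invariant_init: "invariant (scan_init Ps)"
proof -
  let ?S = "\<Sum>P\<leftarrow>Ps. int (P ! 0)"
  have S: "?S = (\<Sum>i<length Ps. int (Ps ! i ! 0))"
    by (simp add: sum_list_sum_nth atLeast0LessThan)
  have adm: "admissible {..<length Ps} prefix m (\<lambda>_. 0) \<longleftrightarrow> ?S \<le> int m" for m
    by (simp add: admissible_prefix S)
  have upper: "reach {..<length Ps} prefix m (\<lambda>_. 0) ((!) (replicate (length Ps) 0))"
    if "?S \<le> int m" for m
  proof -
    have "move {..<length Ps} prefix m (\<lambda>_. 0) (\<lambda>_. 0)"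
      using that adm by (simp add: move_def)
    then have "reach {..<length Ps} prefix m (\<lambda>_. 0) (\<lambda>_. 0)"
      by blast
    then show ?thesis
      by (rule reach_cong) auto
  qed
  have lower: "?S \<le> int m" if "feasible {..<length Ps} prefix m" for m
    using reach_admissible(1)[OF that[unfolded feasible_def]] adm by blast
  have "snd ` (\<lambda>i. (int (Ps ! i ! 1) - int (Ps ! i ! 0), i)) ` {..<length Ps} = {..<length Ps}"
    by (simp add: image_comp comp_def)
  with upper lower show ?thesis
    unfolding invariant_def scan_init_def Let_def by (auto simp: S)
qed

text \<open>
  As long as all positions are at most \<open>I\<close>, each process pays at least its value at \<open>I\<close>, the
  lowest valley so far. Hence the first move beyond \<open>I\<close> costs at least \<open>S + d\<close>, where \<open>d\<close> is
  the minimal key.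
\<close>

lemma lower_bound:
  assumes inv: "invariant (T, S, M, I, Qs)" and min: "minimal_in (d, i) T"
    and adv: "I ! i + 2 \<le> ends ! i" and feas: "feasible {..<length Ps} prefix m"
  shows "S + d \<le> int m"
proof (rule ccontr)
  note D = invariantD[OF inv]
  assume contr: "\<not> S + d \<le> int m"
  moreover have "M \<le> int m"
    by (rule D(12)[OF feas])
  \<comment> \<open>Positivity covers the processes other than \<open>j\<close> below that step
    beyond \<open>I\<close> in the same move: their increase is at least \<open>d\<close>, hence not
    negative.\<close>
  ultimately have d_pos: "d > 0"
    using D(10) by simp
  have stay: "\<forall>j<length Ps. v j \<le> I ! j"
    if mv: "move {..<length Ps} prefix m u v" and u: "\<forall>j<length Ps. u j \<le> I ! j" for u v
  proof (rule ccontr)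
    assume "\<not> (\<forall>j<length Ps. v j \<le> I ! j)"
    then obtain j where j: "j < length Ps" "v j > I ! j"
      by (auto simp: not_le)
    have v: "v k \<le> I ! k \<or> v k = Suc (I ! k)" "v k \<le> ends ! k" if "k < length Ps" for k
    proof -
      have "v k = u k \<or> v k = Suc (u k)" "u k \<le> I ! k"
        using mv u that by (auto simp: move_def)
      then show "v k \<le> I ! k \<or> v k = Suc (I ! k)"
        by auto
      show "v k \<le> ends ! k"
        using mv that by (auto simp: move_def admissible_prefix)
    qed
    have key: "d \<le> int (Ps ! k ! v k) - int (Ps ! k ! (I ! k))"
      if k: "k < length Ps" "v k = Suc (I ! k)" for k
    proof -
      \<comment> \<open>Positions never leave the prefix, so \<open>k\<close> has not yet reached
        its stop and its key is still in \<open>T\<close>.\<close>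
      have less: "I ! k < ends ! k"
        using v(2)[OF k(1)] k(2) by simp
      then obtain d' where d': "(d', k) \<in> T"
        using D(8)[OF k(1)] by auto
      then have "d \<le> d'"
        using min by (auto simp: minimal_in_def)
      moreover have "d' = int (Ps ! k ! v k) - int (Ps ! k ! (I ! k))"
        using D(7)[OF d'] D(5)[OF k(1)] k less ends_less[of k] by simp
      ultimately show ?thesis
        by simp
    qed
    have "int (Ps ! k ! (I ! k)) + (if k = j then d else 0) \<le> int (Ps ! k ! v k)"
      if k: "k < length Ps" for k
    proof (cases "v k \<le> I ! k")
      case True
      then have "k \<noteq> j"
        using j by auto
      with True show ?thesis
        using scannable[OF k] D(3,4)[OF k] by (auto simp: scannable_def)
    next
      case False
      then have "v k = Suc (I ! k)"
        using v(1)[OF k] by simp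
      with key[OF k] d_pos show ?thesis
        by (cases "k = j") auto
    qed
    then have "(\<Sum>k<length Ps. int (Ps ! k ! (I ! k)) + (if k = j then d else 0))
        \<le> (\<Sum>k<length Ps. int (Ps ! k ! v k))"
      by (intro sum_mono) simp
    also have "\<dots> \<le> int m"
      using mv by (auto simp: move_def admissible_prefix)
    finally have "S + d \<le> int m"
      using j(1) by (simp add: sum.distrib D(9))
    with contr show False
      by simp
  qed
  \<comment> \<open>The path is thus trapped at or below \<open>I\<close>, whereas process
    \<open>i\<close> still has to travel to its stop.\<close>
  have "reach {..<length Ps} prefix m (\<lambda>_. 0) (\<lambda>j. length (prefix j) - 1)"
    using feas by (simp add: feasible_def)
  then have "\<forall>j<length Ps. length (prefix j) - 1 \<le> I ! j"
    by induction (use stay in auto)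
  moreover have "i < length Ps"
    using min D(7)[of d i] by (simp add: minimal_in_def)
  ultimately show False
    using adv length_prefix by fastforce
qed

text \<open>\<open>advance\<close> extends the path over one peak, at cost \<open>S + d\<close>, to
  a valley no higher than the present one; \<open>lower_bound\<close> shows that this cost is
  unavoidable. \<open>stop\<close> never loses an unfinished process: position and stop are both
  even, so fewer than two steps left means none.\<close>

lemma invariant_step:
  assumes inv: "invariant x" and step: "scan_step ends x y"
  shows "invariant y"
  using step
proof cases
  case (advance d i T I P Qs T' S M)
  note D = invariantD[OF inv[unfolded advance(1)]]
  let ?n = "length Ps" and ?e = "I ! i"
  let ?I = "I[i := ?e + 2]" and ?Qs = "Qs[i := drop 2 P]"
  let ?d = "int (Ps ! i ! (?e + 2)) - int (Ps ! i ! ?e)"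
  have dT: "(d, i) \<in> T"
    using advance(3) by (simp add: minimal_in_def)
  have i: "i < ?n" and d: "d = int (Qs ! i ! 1) - int (Qs ! i ! 0)"
    using D(7)[OF dT] by auto
  have e: "?e + 2 < length (Ps ! i)"
    using advance(4) ends_less[OF i] by simp
  have P: "P = drop ?e (Ps ! i)"
    using advance(5) D(5)[OF i] by simp
  have d': "d = int (Ps ! i ! (?e + 1)) - int (Ps ! i ! ?e)"
    using d e D(5)[OF i] by simp
  have P2: "int (P ! 2) - int (P ! 0) = ?d"
    using P e by simp
  have upd: "(\<Sum>j<?n. int (Ps ! j ! (((!) I)(i := k)) j)) = S + int (Ps ! i ! k) - int (Ps ! i ! ?e)" for k
    using i by (simp add: D(9) sum.remove[of "{..<?n}" i])
  have I: "?I ! j = (((!) I)(i := ?e + 2)) j" if "j < ?n" for j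
    using that i D(1) by auto
  have desc: "?d \<le> 0"
    using scannable[OF i] advance(4) D(3)[OF i] by (simp add: scannable_def)
  have upper: "reach {..<?n} prefix m (\<lambda>_. 0) ((!) ?I)" if m: "max M (S + d) \<le> int m" for m
  proof -
    have r: "reach {..<?n} prefix m (\<lambda>_. 0) ((!) I)"
      using D(11) m by simp
    have "admissible {..<?n} prefix m (((!) I)(i := ?e + 1))"
      unfolding admissible_prefix upd using m d' D(4) advance(4) by auto
    moreover have "admissible {..<?n} prefix m (((!) I)(i := ?e + 2))"
      unfolding admissible_prefix upd using m desc D(4,10) advance(4) by auto
    ultimately have "move {..<?n} prefix m ((!) I) (((!) I)(i := ?e + 1))"
      "move {..<?n} prefix m (((!) I)(i := ?e + 1)) (((!) I)(i := ?e + 2))"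
      using reach_admissible(2)[OF r] by (auto simp: move_def)
    with r have "reach {..<?n} prefix m (\<lambda>_. 0) (((!) I)(i := ?e + 2))"
      by (meson tranclp.trancl_into_trancl)
    then show ?thesis
      by (rule reach_cong) (use I in auto)
  qed
  have lower: "max M (S + d) \<le> int m" if "feasible {..<?n} prefix m" for m
    using lower_bound[OF inv[unfolded advance(1)] advance(3,4) that] D(12)[OF that] by simp
  have keys: "j < ?n \<and> k = int (?Qs ! j ! 1) - int (?Qs ! j ! 0)" if "(k, j) \<in> T'" for k j
  proof (cases "j = i")
    case True
    \<comment> \<open>A key is determined by the current position, so \<open>(d, i)\<close> was the
      only entry of process \<open>i\<close>.\<close>
    then have "(k, j) \<notin> T - {(d, i)}"
      using D(7)[of k j] d by auto
    with that True have "length P \<ge> 4" "k = int (P ! 3) - int (P ! 2)"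
      using advance(6) by (auto split: if_splits)
    with True i D(2) show ?thesis
      by (simp add: numeral_3_eq_3 numeral_2_eq_2)
  next
    case False
    then have "(k, j) \<in> T"
      using that advance(6) by (auto split: if_splits)
    with False D(7)[of k j] show ?thesis
      by simp
  qed
  have open_keys: "j \<in> snd ` T'" if "j < ?n" "?I ! j < ends ! j" for j
  proof (cases "j = i")
    case True
    then have "?e + 2 < ends ! i"
      using that i D(1) by simp
    \<comment> \<open>By parity at least two more steps remain after the advance, so the old list
      \<open>P\<close> has at least four elements and the next key is inserted.\<close>
    moreover have "even (ends ! i)"
      using scannable[OF i] by (simp add: scannable_def)
    then have "?e + 3 \<noteq> ends ! i"
      using D(3)[OF i] by (metis even_add odd_numeral)
    ultimately have "?e + 3 < ends ! i"
      by simp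
    then have "length P \<ge> 4"
      using P ends_less[OF i] by simp
    then have "(int (P ! 3) - int (P ! 2), i) \<in> T'"
      using advance(6) by simp
    with True show ?thesis
      by force
  next
    case False
    then have "j \<in> snd ` T"
      using D(8)[of j] that by simp
    then obtain k where "(k, j) \<in> T"
      by auto
    with False have "(k, j) \<in> T'"
      using advance(6) by simp
    then show ?thesis
      by force
  qed
  have "even (?I ! j) \<and> ?I ! j \<le> ends ! j \<and> ?Qs ! j = drop (?I ! j) (Ps ! j)" if "j < ?n" for j
    using that i D(1-5) advance(4) P by (cases "j = i") (auto simp: add.commute)
  moreover have "S + ?d = (\<Sum>j<?n. int (Ps ! j ! (?I ! j)))"
    using upd[of "?e + 2"] I by simp
  moreover have "finite T'"
    using advance(6) D(6) by simp
  ultimately show ?thesis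
    unfolding invariant_def advance(2) P2
    using D(1,2,10) keys open_keys desc upper lower by auto
next
  case (stop d i T I S M Qs)
  note D = invariantD[OF inv[unfolded stop(1)]]
  have dT: "(d, i) \<in> T"
    using stop(3) by (simp add: minimal_in_def)
  have i: "i < length Ps"
    using D(7)[OF dT] by simp
  have "even (ends ! i)"
    using scannable[OF i] by (simp add: scannable_def)
  then have "I ! i + 1 \<noteq> ends ! i"
    using D(3)[OF i] by (metis even_add odd_one)
  then have "\<not> I ! i < ends ! i"
    using stop(4) by simp
  then have "j \<in> snd ` (T - {(d, i)})" if "j < length Ps" "I ! j < ends ! j" for j
    using D(8)[OF that] that by force
  with inv show ?thesis
    unfolding stop(1,2) by (auto simp: invariant_def)
qed

section \<open>Termination and result of the scan\<close>

definition remaining :: "scan_state \<Rightarrow> nat" where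
  "remaining = (\<lambda>(T, S, M, I, Qs). (\<Sum>i<length Ps. ends ! i - I ! i) + card T)"

text \<open>\<open>advance\<close> brings a process closer to its stop without enlarging the tree,
  and \<open>stop\<close> removes an entry.\<close>

lemma remaining_step:
  assumes inv: "invariant x" and step: "scan_step ends x y"
  shows "remaining y < remaining x"
  using step
proof cases
  case (advance d i T I P Qs T' S M)
  note D = invariantD[OF inv[unfolded advance(1)]]
  let ?n = "length Ps" and ?I = "I[i := I ! i + 2]"
  have dT: "(d, i) \<in> T"
    using advance(3) by (simp add: minimal_in_def)
  then have i: "i < ?n"
    using D(7) by blast
  have "card T' \<le> card (T - {(d, i)}) + 1"
    unfolding advance(6) by (rule order_trans[OF card_Un_le]) auto
  also have "\<dots> = card T"
    using card.remove[OF D(6) dT] by simp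
  finally have "card T' \<le> card T" .
  moreover have "(\<Sum>j<?n. ends ! j - ?I ! j) < (\<Sum>j<?n. ends ! j - I ! j)"
  proof (rule sum_strict_mono_ex1)
    show "\<forall>j\<in>{..<?n}. ends ! j - ?I ! j \<le> ends ! j - I ! j"
    proof
      fix j
      show "ends ! j - ?I ! j \<le> ends ! j - I ! j"
        using i D(1) by (cases "j = i") auto
    qed
    show "\<exists>j\<in>{..<?n}. ends ! j - ?I ! j < ends ! j - I ! j"
      using i D(1) advance(4) by (intro bexI[of _ i]) auto
  qed simp
  ultimately show ?thesis
    by (simp add: remaining_def advance(1,2))
next
  case (stop d i T I S M Qs)
  note D = invariantD[OF inv[unfolded stop(1)]]
  have "(d, i) \<in> T"
    using stop(3) by (simp add: minimal_in_def)
  then show ?thesis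
    using card_Diff1_less[OF D(6)] by (simp add: remaining_def stop(1,2))
qed

lemma terminates: "scan_terminates ends Ps"
  unfolding scan_terminates_def
proof
  assume "\<exists>f. f 0 = scan_init Ps \<and> (\<forall>n. scan_step ends (f n) (f (Suc n)))"
  then obtain f where f: "f 0 = scan_init Ps" "\<And>n. scan_step ends (f n) (f (Suc n))"
    by blast
  have inv: "invariant (f n)" for n
    by (induction n) (use f invariant_init invariant_step in auto)
  have "remaining (f n) + n \<le> remaining (f 0)" for n
  proof (induction n)
    case (Suc n)
    then show ?case
      using remaining_step[OF inv f(2), of n] by simp
  qed simp
  from this[of "Suc (remaining (f 0))"] show False
    by simp
qed

lemma progress:
  assumes "invariant (T, S, M, I, Qs)" "T \<noteq> {}"
  shows "\<exists>y. scan_step ends (T, S, M, I, Qs) y"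
proof -
  have "Min (fst ` T) \<in> fst ` T"
    using assms invariantD(6) by simp
  then obtain d i where di: "(d, i) \<in> T" "d = Min (fst ` T)"
    by auto
  then have min: "minimal_in (d, i) T"
    using invariantD(6)[OF assms(1)] by (auto simp: minimal_in_def)
  show ?thesis
  proof (cases "I ! i + 2 \<le> ends ! i")
    case True
    from scan_step.advance[OF min this refl refl] show ?thesis ..
  next
    case False
    from scan_step.stop[OF min this] show ?thesis ..
  qed
qed

lemma reaches_empty:
  assumes "invariant x"
  shows "\<exists>S M I Qs. (scan_step ends)\<^sup>*\<^sup>* x ({}, S, M, I, Qs)"
  using assms
proof (induction x rule: measure_induct_rule[of remaining])
  case (less x)
  obtain T S M I Qs where x: "x = (T, S, M, I, Qs)"
    by (cases x) auto
  show ?case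
  proof (cases "T = {}")
    case True
    with x show ?thesis
      by blast
  next
    case False
    then obtain y where y: "scan_step ends x y"
      using progress less.prems x by blast
    with less show ?thesis
      using remaining_step[OF less.prems y] invariant_step[OF less.prems y]
      by (meson converse_rtranclp_into_rtranclp)
  qed
qed

lemma returns_ex: "\<exists>m. scan_returns ends Ps m"
  using reaches_empty[OF invariant_init] unfolding scan_returns_def by blast

text \<open>With an empty tree every process is at its stop, so the two optimality clauses of
  \<open>invariant\<close> meet at the final positions. This applies to every run, however ties were
  broken.\<close>

lemma returns_bound:
  assumes "scan_returns ends Ps r"
  shows "0 \<le> r" "r \<le> int m \<longleftrightarrow> feasible {..<length Ps} prefix m"
proof -
  obtain S I Qs where run: "(scan_step ends)\<^sup>*\<^sup>* (scan_init Ps) ({}, S, r, I, Qs)"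
    using assms by (auto simp: scan_returns_def)
  then have inv: "invariant ({}, S, r, I, Qs)"
    by induction (use invariant_init invariant_step in auto)
  note D = invariantD[OF inv]
  have "0 \<le> S"
    by (simp add: D(9) sum_nonneg)
  with D(10) show "0 \<le> r"
    by simp
  have I: "I ! i = ends ! i" if "i < length Ps" for i
    using D(4,8)[OF that] by force
  show "r \<le> int m \<longleftrightarrow> feasible {..<length Ps} prefix m"
  proof
    assume "r \<le> int m"
    with D(11) show "feasible {..<length Ps} prefix m"
      by (subst feasible_iff_reach[where s = "\<lambda>_. 0" and t = "(!) I"])
        (auto simp: I length_prefix)
  qed (rule D(12))
qed

end

section \<open>Correctness of the algorithm\<close>

lemma reach_take:
  assumes "reach A (\<lambda>i. take (e i) (p i)) m s t"
  shows "reach A p m s t"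
proof -
  have adm: "admissible A p m u" if "admissible A (\<lambda>i. take (e i) (p i)) m u" for u
    by (rule admissible_mono[OF that]) auto
  show ?thesis
  proof (rule reach_map[OF assms, where h = "\<lambda>s. s"])
    fix u v assume "move A (\<lambda>i. take (e i) (p i)) m u v"
    then have "move A p m u v"
      using adm by (auto simp: move_def)
    then show "reach A p m u v"
      by blast
  qed
qed

text \<open>A process that would go beyond its valley waits there instead, at no higher
  cost.\<close>

lemma feasible_take:
  assumes "feasible A p m" "\<And>i. i \<in> A \<Longrightarrow> e i < length (p i)"
    and "\<And>i l. i \<in> A \<Longrightarrow> l < length (p i) \<Longrightarrow> p i ! e i \<le> p i ! l"
  shows "feasible A (\<lambda>i. take (Suc (e i)) (p i)) m"
proof (rule feasible_dominates[OF assms(1)])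
  fix i assume i: "i \<in> A"
  show "dominates (p i) (take (Suc (e i)) (p i))"
    unfolding dominates_def
    by (intro exI[of _ "\<lambda>j. min j (e i)"]) (use i assms(2,3)[OF i] in \<open>auto simp: min_def\<close>)
qed

text \<open>Waiting at the valleys turns a full path into each half; conversely the halves join
  where all processes are at their valleys, the second one being run backwards.\<close>

lemma feasible_split_at_valleys:
  assumes "\<And>i. i \<in> A \<Longrightarrow> e i < length (p i)"
    and "\<And>i l. i \<in> A \<Longrightarrow> l < length (p i) \<Longrightarrow> p i ! e i \<le> p i ! l"
  shows "feasible A p m \<longleftrightarrow> feasible A (\<lambda>i. take (Suc (e i)) (p i)) m \<and>
    feasible A (\<lambda>i. take (Suc (length (p i) - 1 - e i)) (rev (p i))) m"
proof (intro iffI conjI)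
  let ?e = "\<lambda>i. length (p i) - 1 - e i"
  have rev_e: "rev (p i) ! ?e i = p i ! e i" if "i \<in> A" for i
    using assms(1)[OF that] by (simp add: rev_nth Suc_diff_Suc)
  {
    assume f: "feasible A p m"
    then show "feasible A (\<lambda>i. take (Suc (e i)) (p i)) m"
      using assms by (rule feasible_take)
    have "feasible A (\<lambda>i. rev (p i)) m"
      using f by (simp add: feasible_rev)
    then show "feasible A (\<lambda>i. take (Suc (?e i)) (rev (p i))) m"
    proof (rule feasible_take)
      fix i assume i: "i \<in> A"
      then show "?e i < length (rev (p i))"
        using assms(1)[OF i] by simp
      fix l assume "l < length (rev (p i))"
      then show "rev (p i) ! ?e i \<le> rev (p i) ! l"
        unfolding rev_e[OF i] using assms(2)[OF i] by (simp add: rev_nth)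
    qed
  }
  assume *: "feasible A (\<lambda>i. take (Suc (e i)) (p i)) m \<and>
    feasible A (\<lambda>i. take (Suc (?e i)) (rev (p i))) m"
  then have "reach A (\<lambda>i. take (Suc (e i)) (p i)) m (\<lambda>_. 0) e"
    using assms(1) by (subst (asm) (1) feasible_iff_reach[where s = "\<lambda>_. 0" and t = e])
      (auto simp: min_absorb2 Suc_leI)
  then have l: "reach A p m (\<lambda>_. 0) e"
    by (rule reach_take)
  have "reach A (\<lambda>i. take (Suc (?e i)) (rev (p i))) m (\<lambda>_. 0) ?e"
    using conjunct2[OF *] assms(1)
    by (subst (asm) feasible_iff_reach[where s = "\<lambda>_. 0" and t = ?e]) auto
  then have "reach A (\<lambda>i. rev (p i)) m (\<lambda>_. 0) ?e"
    by (rule reach_take)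
  from reach_rev[OF this] have "reach A p m (\<lambda>i. length (p i) - 1 - ?e i) (\<lambda>i. length (p i) - 1)"
    by simp
  \<comment> \<open>Reflecting twice gives back \<open>e\<close> on \<open>A\<close>, where the
    valleys are in range.\<close>
  then have "reach A p m e (\<lambda>i. length (p i) - 1)"
    by (rule reach_cong) (use assms(1) in force)+
  with l show "feasible A p m"
    unfolding feasible_def by (rule tranclp_trans)
qed

lemma scan_problem_left:
  assumes "\<forall>Q\<in>set Qs. zigzag Q"
  shows "scan_problem Qs (left_ends Qs)"
  using assms scannable_left by unfold_locales (simp add: left_ends_def)

lemma scan_problem_right:
  assumes "\<forall>Q\<in>set Qs. zigzag Q"
  shows "scan_problem (map rev Qs) (right_ends Qs)"
  using assms scannable_right by unfold_locales (simp add: right_ends_def)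

lemma scans_bound:
  assumes Qs: "\<forall>Q\<in>set Qs. zigzag Q"
    and left: "left_scan_returns Qs ml" and right: "right_scan_returns Qs mr"
  shows "feasible {..<length Qs} ((!) Qs) m \<longleftrightarrow> ml \<le> int m \<and> mr \<le> int m"
proof -
  interpret L: scan_problem Qs "left_ends Qs"
    by (rule scan_problem_left[OF Qs])
  interpret R: scan_problem "map rev Qs" "right_ends Qs"
    by (rule scan_problem_right[OF Qs])
  let ?e = "\<lambda>i. rightmost_valley (Qs ! i)"
  have ne: "Qs ! i \<noteq> []" if "i \<in> {..<length Qs}" for i
    using Qs that by (auto simp: zigzag_def)
  have "feasible {..<length Qs} ((!) Qs) m \<longleftrightarrow>
      feasible {..<length Qs} (\<lambda>i. take (Suc (?e i)) (Qs ! i)) m \<and>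
      feasible {..<length Qs} (\<lambda>i. take (Suc (length (Qs ! i) - 1 - ?e i)) (rev (Qs ! i))) m"
    by (rule feasible_split_at_valleys) (use rightmost_valley ne in blast)+
  moreover have "feasible {..<length Qs} (\<lambda>i. take (Suc (?e i)) (Qs ! i)) m \<longleftrightarrow>
      feasible {..<length Qs} L.prefix m"
    by (rule feasible_cong) (unfold L.prefix_def, simp add: left_ends_def)
  moreover have "feasible {..<length Qs} (\<lambda>i. take (Suc (length (Qs ! i) - 1 - ?e i)) (rev (Qs ! i))) m
      \<longleftrightarrow> feasible {..<length Qs} R.prefix m"
    by (rule feasible_cong) (unfold R.prefix_def, simp add: right_ends_def)
  ultimately show ?thesis
    using L.returns_bound(2)[of ml m] R.returns_bound(2)[of mr m] left right
    by (simp add: left_scan_returns_def right_scan_returns_def)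
qed

lemma those_map_Some:
  assumes "\<forall>x\<in>set xs. \<exists>y. f x = Some y"
  shows "those (map f xs) = Some (map (\<lambda>x. the (f x)) xs)"
  using assms by (induction xs) auto

lemma standardize_correct:
  assumes "\<forall>P\<in>set Ps. P \<noteq> []"
  shows "\<exists>Qs c. standardize Ps = Some (Qs, c) \<and> (\<forall>Q\<in>set Qs. zigzag Q) \<and>
    (\<forall>m. feasible {..<length Ps} ((!) Ps) m \<longleftrightarrow>
      (\<Sum>P\<leftarrow>Ps. hd P) \<le> m \<and> (\<Sum>P\<leftarrow>Ps. last P) \<le> m \<and> c \<le> m \<and>
      feasible {..<length Qs} ((!) Qs) (m - c))"
proof -
  let ?n = "length Ps"
  define Rs where "Rs = map (\<lambda>P. the (reduce P)) Ps"
  define Zs where "Zs = map (\<lambda>R. remove_end_peak (remove_start_peak R)) Rs"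
  define c where "c = (\<Sum>Q\<leftarrow>filter (\<lambda>Q. length Q = 1) Zs. Q ! 0)"
  define Qs where "Qs = filter (\<lambda>Q. length Q \<noteq> 1) Zs"
  have red: "reduce P = Some (the (reduce P)) \<and> interchangeable P (the (reduce P)) \<and>
      (\<forall>i. \<not> pattern_at (the (reduce P)) i)" if "P \<in> set Ps" for P
    using reduce_correct[of P] assms that by fastforce
  have "those (map reduce Ps) = Some Rs"
    unfolding Rs_def by (rule those_map_Some) (use red in blast)
  then have std: "standardize Ps = Some (Qs, c)"
    by (simp add: standardize_def Zs_def c_def Qs_def Let_def)
  have R: "interchangeable (Ps ! i) (Rs ! i)" "\<And>j. \<not> pattern_at (Rs ! i) j" if "i < ?n" for i
    using that red[of "Ps ! i"] by (auto simp: Rs_def)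
  have R_ne: "Rs ! i \<noteq> []" if "i < ?n" for i
    using R(1)[OF that] interchangeableD(2) by blast
  have Z: "Zs ! i = remove_end_peak (remove_start_peak (Rs ! i))" if "i < ?n" for i
    using that by (simp add: Zs_def Rs_def)
  have len: "length Zs = ?n"
    by (simp add: Zs_def Rs_def)
  have zigzag: "zigzag (Zs ! i)" if "i < ?n" for i
    unfolding Z[OF that] using R(2)[OF that] R_ne[OF that] by (intro zigzag_remove_peaks)
  then have "\<forall>Q\<in>set Qs. zigzag Q"
    using len by (auto simp: Qs_def in_set_conv_nth)
  moreover have "feasible {..<?n} ((!) Ps) m \<longleftrightarrow>
      (\<Sum>P\<leftarrow>Ps. hd P) \<le> m \<and> (\<Sum>P\<leftarrow>Ps. last P) \<le> m \<and> c \<le> m \<and>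
      feasible {..<length Qs} ((!) Qs) (m - c)" for m
  proof -
    let ?S = "\<lambda>i. remove_start_peak (Rs ! i)"
    \<comment> \<open>Only lists with two or more elements lose their start-peak, so the last
      element survives.\<close>
    have last_S: "last (?S i) = last (Ps ! i)" if "i < ?n" for i
    proof -
      have "last (?S i) = last (Rs ! i)"
        by (cases "Rs ! i") (auto simp: remove_start_peak_def)
      then show ?thesis
        using interchangeableD(4)[OF R(1)[OF that]] by simp
    qed
    have "feasible {..<?n} ((!) Ps) m \<longleftrightarrow> feasible {..<?n} ((!) Rs) m"
      by (rule feasible_interchangeable) (use R(1) in auto)
    also have "\<dots> \<longleftrightarrow> (\<Sum>i<?n. hd (Rs ! i)) \<le> m \<and> feasible {..<?n} ?S m"
      by (rule feasible_remove_start_peak) (use R_ne in auto)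
    also have "(\<Sum>i<?n. hd (Rs ! i)) = (\<Sum>P\<leftarrow>Ps. hd P)"
      using interchangeableD(3)[OF R(1)] by (simp add: sum_list_sum_nth atLeast0LessThan)
    also have "feasible {..<?n} ?S m \<longleftrightarrow>
        (\<Sum>i<?n. last (?S i)) \<le> m \<and> feasible {..<?n} (\<lambda>i. remove_end_peak (?S i)) m"
      by (rule feasible_remove_end_peak) (use R_ne in auto)
    also have "(\<Sum>i<?n. last (?S i)) = (\<Sum>P\<leftarrow>Ps. last P)"
      using last_S by (simp add: sum_list_sum_nth atLeast0LessThan)
    also have "feasible {..<?n} (\<lambda>i. remove_end_peak (?S i)) m \<longleftrightarrow> feasible {..<?n} ((!) Zs) m"
      by (rule feasible_cong) (simp add: Z)
    also have "feasible {..<?n} ((!) Zs) m \<longleftrightarrow> c \<le> m \<and> feasible {..<length Qs} ((!) Qs) (m - c)"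
    proof -
      let ?B = "{i. i < ?n \<and> length (Zs ! i) \<noteq> 1}"
      \<comment> \<open>The surviving indices in increasing order provide the renumbering between
        \<open>Zs\<close> and \<open>Qs\<close>.\<close>
      define idx where "idx = filter (\<lambda>i. length (Zs ! i) \<noteq> 1) [0..<?n]"
      have c: "(\<Sum>i\<in>{..<?n}-?B. Zs ! i ! 0) = c"
      proof -
        have "c = (\<Sum>i<?n. if length (Zs ! i) = 1 then Zs ! i ! 0 else 0)"
          unfolding c_def sum_list_map_filter'
          by (simp add: sum_list_sum_nth atLeast0LessThan len)
        also have "\<dots> = (\<Sum>i\<in>{..<?n}-?B. Zs ! i ! 0)"
          by (subst sum.inter_filter[symmetric]) (auto intro: sum.cong)
        finally show ?thesis ..
      qed
      have Qs_idx: "Qs = map ((!) Zs) idx"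
        using filter_map[of "\<lambda>Q. length Q \<noteq> 1" "(!) Zs" "[0..<?n]"] map_nth[of Zs]
        by (simp add: Qs_def idx_def len comp_def)
      have "bij_betw ((!) idx) {..<length idx} ?B"
        by (rule bij_betw_nth) (auto simp: idx_def)
      then have "feasible ?B ((!) Zs) k \<longleftrightarrow> feasible {..<length idx} (\<lambda>j. Zs ! (idx ! j)) k" for k
        by (rule feasible_reindex)
      also have "feasible {..<length idx} (\<lambda>j. Zs ! (idx ! j)) k \<longleftrightarrow>
          feasible {..<length Qs} ((!) Qs) k" for k
        unfolding Qs_idx length_map by (rule feasible_cong) simp
      finally show ?thesis
        using feasible_remove_singletons[of "{..<?n}" ?B "(!) Zs" m] c by auto
    qed
    finally show ?thesis
      by auto
  qed
  ultimately show ?thesis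
    using std by blast
qed

section \<open>Lattice paths and interleavings\<close>

lemma sum_list_map2_nth:
  assumes "length s = length Ps"
  shows "sum_list (map2 (!) Ps s) = cost {..<length Ps} ((!) Ps) ((!) s)"
  using assms by (simp add: cost_def sum_list_sum_nth atLeast0LessThan)

text \<open>The definition of interleavings does not state that indices are in range; it follows
  because they never decrease and end at the last positions.\<close>

lemma interleaving_imp_feasible:
  assumes ne: "\<forall>P\<in>set Ps. P \<noteq> []" and qs: "interleaving Ps qs"
  shows "feasible {..<length Ps} ((!) Ps) (sps qs)"
proof -
  let ?n = "length Ps"
  obtain ss where ss: "ss \<noteq> []" "\<forall>s\<in>set ss. length s = ?n"
      "hd ss = map (\<lambda>P. 0) Ps" "last ss = map (\<lambda>P. length P - 1) Ps"
      "qs = map (\<lambda>s. map2 (!) Ps s) ss"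
    and steps: "\<And>t i. Suc t < length ss \<Longrightarrow> i < ?n \<Longrightarrow>
      ss ! Suc t ! i = ss ! t ! i \<or> ss ! Suc t ! i = ss ! t ! i + 1"
    using qs unfolding interleaving_def by blast
  have mono: "ss ! t ! i \<le> ss ! (t + d) ! i" if "t + d < length ss" "i < ?n" for t d i
    using that(1)
  proof (induction d)
    case (Suc d)
    then show ?case
      using steps[of "t + d" i] that(2) by auto
  qed simp
  have last: "ss ! (length ss - 1) ! i = length (Ps ! i) - 1" if "i < ?n" for i
    using ss(1,4) that by (simp add: last_conv_nth)
  have adm: "admissible {..<?n} ((!) Ps) (sps qs) ((!) (ss ! t))" if t: "t < length ss" for t
  proof -
    have "ss ! t ! i < length (Ps ! i)" if "i < ?n" for i
    proof -
      have "ss ! t ! i \<le> length (Ps ! i) - 1"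
        using mono[of t "length ss - 1 - t" i] last[OF that] t that by simp
      moreover have "Ps ! i \<noteq> []"
        using ne that by simp
      ultimately show ?thesis
        by (cases "Ps ! i") auto
    qed
    moreover have "cost {..<?n} ((!) Ps) ((!) (ss ! t)) = sum_list (qs ! t)"
      using ss(2,5) t by (simp add: sum_list_map2_nth)
    moreover have "sum_list (qs ! t) \<le> sps qs"
      unfolding sps_def using ss(5) t by (intro Max_ge) auto
    ultimately show ?thesis
      by (simp add: admissible_def)
  qed
  have "reach {..<?n} ((!) Ps) (sps qs) ((!) (ss ! 0)) ((!) (ss ! t))" if "t < length ss" for t
    using that
  proof (induction t)
    case 0
    have "move {..<?n} ((!) Ps) (sps qs) ((!) (ss ! 0)) ((!) (ss ! 0))"
      using adm[OF 0] by (simp add: move_def)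
    then show ?case
      by blast
  next
    case (Suc t)
    then have "move {..<?n} ((!) Ps) (sps qs) ((!) (ss ! t)) ((!) (ss ! Suc t))"
      using adm[of t] adm[of "Suc t"] steps[of t] by (auto simp: move_def)
    with Suc show ?case
      by (meson Suc_lessD tranclp.trancl_into_trancl)
  qed
  from this[of "length ss - 1"]
  have "reach {..<?n} ((!) Ps) (sps qs) ((!) (ss ! 0)) ((!) (ss ! (length ss - 1)))"
    using ss(1) by simp
  then show ?thesis
    using last ss(1,3) by (subst feasible_iff_reach) (auto simp: hd_conv_nth)
qed

text \<open>Moves that leave all relevant positions unchanged have to be skipped, since consecutive
  index tuples of an interleaving differ.\<close>

lemma feasible_imp_interleaving:
  assumes "feasible {..<length Ps} ((!) Ps) m"
  shows "\<exists>qs. interleaving Ps qs \<and> sps qs \<le> m"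
proof -
  let ?n = "length Ps"
  define steps where "steps ss \<longleftrightarrow> (\<forall>t. Suc t < length ss \<longrightarrow>
    ss ! Suc t \<noteq> ss ! t \<and>
    (\<forall>i<?n. ss ! Suc t ! i = ss ! t ! i \<or> ss ! Suc t ! i = ss ! t ! i + 1))" for ss :: "nat list list"
  define good where "good ss \<longleftrightarrow> ss \<noteq> [] \<and>
    (\<forall>s\<in>set ss. length s = ?n \<and> cost {..<?n} ((!) Ps) ((!) s) \<le> m) \<and>
    hd ss = map (\<lambda>P. 0) Ps \<and> steps ss" for ss
  define path where "path u \<longleftrightarrow> (\<exists>ss. good ss \<and> last ss = map u [0..<?n])" for u
  have cost_map: "cost {..<?n} ((!) Ps) ((!) (map u [0..<?n])) = cost {..<?n} ((!) Ps) u" for u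
    by (simp add: cost_def)
  have r: "reach {..<?n} ((!) Ps) m (\<lambda>_. 0) (\<lambda>i. length (Ps ! i) - 1)"
    using assms by (simp add: feasible_def)
  have start: "path (\<lambda>_. 0)"
    unfolding path_def
  proof (intro exI conjI)
    show "good [map (\<lambda>_. 0) [0..<?n]]"
      using reach_admissible(1)[OF r]
      by (simp add: good_def steps_def admissible_def cost_def map_replicate_const)
  qed simp
  have step: "path v" if uv: "path u" "move {..<?n} ((!) Ps) m u v" for u v
  proof -
    obtain ss where ss: "good ss" "last ss = map u [0..<?n]"
      using uv(1) by (auto simp: path_def)
    show ?thesis
    proof (cases "map v [0..<?n] = map u [0..<?n]")
      case True
      with ss show ?thesis
        by (auto simp: path_def)
    next
      case False
      let ?x = "map v [0..<?n]"
      have ne: "ss \<noteq> []"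
        using ss(1) by (simp add: good_def)
      have "steps (ss @ [?x])"
        unfolding steps_def
      proof (intro allI impI)
        fix t assume t: "Suc t < length (ss @ [?x])"
        let ?goal = "\<lambda>a b. a \<noteq> b \<and> (\<forall>i<?n. a ! i = b ! i \<or> a ! i = b ! i + 1)"
        show "?goal ((ss @ [?x]) ! Suc t) ((ss @ [?x]) ! t)"
        proof (cases "Suc t < length ss")
          case True
          then show ?thesis
            using ss(1) by (simp add: good_def steps_def nth_append)
        next
          case f: False
          then have "t = length ss - 1"
            using t by simp
          then have "(ss @ [?x]) ! t = map u [0..<?n]" "(ss @ [?x]) ! Suc t = ?x"
            using ne ss(2) by (simp_all add: nth_append last_conv_nth)
          then show ?thesis
            using False uv(2) by (auto simp: move_def)
        qed
      qed
      then have "good (ss @ [?x])"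
        using ss(1) uv(2) ne by (auto simp: good_def cost_map move_def admissible_def)
      then show ?thesis
        unfolding path_def by (intro exI[of _ "ss @ [?x]"]) simp
    qed
  qed
  from r have "path (\<lambda>i. length (Ps ! i) - 1)"
    by induction (use step start in blast)+
  then obtain ss where ss: "good ss" "last ss = map (\<lambda>i. length (Ps ! i) - 1) [0..<?n]"
    by (auto simp: path_def)
  let ?qs = "map (\<lambda>s. map2 (!) Ps s) ss"
  have "last ss = map (\<lambda>P. length P - 1) Ps"
    using ss(2) by (auto intro: nth_equalityI)
  then have "interleaving Ps ?qs"
    using ss(1) unfolding interleaving_def good_def steps_def by blast
  moreover have "sps ?qs \<le> m"
    unfolding sps_def using ss(1) by (subst Max_le_iff) (auto simp: good_def sum_list_map2_nth)
  ultimately show ?thesis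
    by blast
qed

text \<open>The premise on \<open>k\<close> provides some interleaving, so that the
  \<open>LEAST\<close> in \<open>spmin\<close> is attained.\<close>

lemma spmin_le_iff:
  assumes "\<forall>P\<in>set Ps. P \<noteq> []" and ex: "feasible {..<length Ps} ((!) Ps) k"
  shows "spmin Ps \<le> m \<longleftrightarrow> feasible {..<length Ps} ((!) Ps) m"
proof
  assume "spmin Ps \<le> m"
  have "\<exists>n qs. interleaving Ps qs \<and> sps qs = n"
    using feasible_imp_interleaving[OF ex] by blast
  then have "\<exists>qs. interleaving Ps qs \<and> sps qs = spmin Ps"
    unfolding spmin_def by (rule LeastI_ex)
  then obtain qs where qs: "interleaving Ps qs" "sps qs \<le> m"
    using \<open>spmin Ps \<le> m\<close> by auto
  have adm: "admissible {..<length Ps} ((!) Ps) m u"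
    if "admissible {..<length Ps} ((!) Ps) (sps qs) u" for u
    using that qs(2) by (auto simp: admissible_def)
  have mv: "reach {..<length Ps} ((!) Ps) m u v" if "move {..<length Ps} ((!) Ps) (sps qs) u v" for u v
  proof -
    have "move {..<length Ps} ((!) Ps) m u v"
      using that adm by (auto simp: move_def)
    then show ?thesis
      by blast
  qed
  show "feasible {..<length Ps} ((!) Ps) m"
    using reach_map[of _ _ _ _ _ _ _ m "\<lambda>s. s"] mv interleaving_imp_feasible[OF assms(1) qs(1)]
    unfolding feasible_def by blast
next
  assume "feasible {..<length Ps} ((!) Ps) m"
  then obtain qs where "interleaving Ps qs" "sps qs \<le> m"
    using feasible_imp_interleaving by blast
  moreover from this have "spmin Ps \<le> sps qs"
    unfolding spmin_def by (intro Least_le) blast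
  ultimately show "spmin Ps \<le> m"
    by simp
qed

theorem theorem5p5:
  fixes Ps :: "nat list list"
  assumes "length Ps \<ge> 1"
    and "\<forall>P\<in>set Ps. P \<noteq> []"
  shows "SpOptN_terminates Ps \<and> (\<forall>r. SpOptN_returns Ps r \<longleftrightarrow> r = int (spmin Ps))"
proof -
  obtain Qs c where std: "standardize Ps = Some (Qs, c)" and Qs: "\<forall>Q\<in>set Qs. zigzag Q"
    and feas: "\<And>m. feasible {..<length Ps} ((!) Ps) m \<longleftrightarrow>
      (\<Sum>P\<leftarrow>Ps. hd P) \<le> m \<and> (\<Sum>P\<leftarrow>Ps. last P) \<le> m \<and> c \<le> m \<and>
      feasible {..<length Qs} ((!) Qs) (m - c)"
    using standardize_correct[OF assms(2)] by blast
  interpret L: scan_problem Qs "left_ends Qs"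
    by (rule scan_problem_left[OF Qs])
  interpret R: scan_problem "map rev Qs" "right_ends Qs"
    by (rule scan_problem_right[OF Qs])
  have "SpOptN_terminates Ps"
    using std L.terminates R.terminates
    by (simp add: SpOptN_terminates_def left_scan_terminates_def right_scan_terminates_def)
  moreover have "r = int (spmin Ps)" if ret: "SpOptN_returns Ps r" for r
  proof -
    obtain ml mr where ml: "left_scan_returns Qs ml" and mr: "right_scan_returns Qs mr"
      and r: "r = Max {ml + int c, mr + int c, (\<Sum>P\<leftarrow>Ps. int (hd P)), (\<Sum>P\<leftarrow>Ps. int (last P))}"
      using ret std unfolding SpOptN_returns_def by auto
    have pos: "0 \<le> ml" "0 \<le> mr"
      using L.returns_bound(1) R.returns_bound(1) ml mr
      by (simp_all add: left_scan_returns_def right_scan_returns_def)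
    have sums: "(\<Sum>P\<leftarrow>Ps. int (hd P)) = int (\<Sum>P\<leftarrow>Ps. hd P)"
      "(\<Sum>P\<leftarrow>Ps. int (last P)) = int (\<Sum>P\<leftarrow>Ps. last P)"
      by (induction Ps) auto
    have bound: "r \<le> int m \<longleftrightarrow> feasible {..<length Ps} ((!) Ps) m" for m
    proof -
      have "r \<le> int m \<longleftrightarrow> ml + int c \<le> int m \<and> mr + int c \<le> int m \<and>
          (\<Sum>P\<leftarrow>Ps. hd P) \<le> m \<and> (\<Sum>P\<leftarrow>Ps. last P) \<le> m"
        unfolding r sums by simp
      \<comment> \<open>Nonnegative scan results make \<open>ml + int c \<le> int m\<close> imply
        \<open>c \<le> m\<close>, so the truncated \<open>m - c\<close> is a true
        difference.\<close>
      also have "\<dots> \<longleftrightarrow> feasible {..<length Ps} ((!) Ps) m"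
        unfolding feas scans_bound[OF Qs ml mr] using pos by auto
      finally show ?thesis .
    qed
    have "0 \<le> r"
      using pos by (simp add: r)
    then have r_nat: "r = int (nat r)"
      by simp
    \<comment> \<open>The returned value is itself feasible, which supplies the premise on
      \<open>k\<close> in \<open>spmin_le_iff\<close>.\<close>
    then have "feasible {..<length Ps} ((!) Ps) (nat r)"
      using bound[of "nat r"] by simp
    then have spmin: "spmin Ps \<le> m \<longleftrightarrow> r \<le> int m" for m
      using spmin_le_iff[OF assms(2)] bound by blast
    \<comment> \<open>The common upper bounds are evaluated at each of the two values.\<close>
    from spmin[of "nat r"] spmin[of "spmin Ps"] r_nat show ?thesis
      by linarith
  qed
  moreover have "\<exists>r. SpOptN_returns Ps r"
    using L.returns_ex R.returns_ex std
    by (auto simp: SpOptN_returns_def left_scan_returns_def right_scan_returns_def)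
  ultimately show ?thesis
    by metis
qed

end
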